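(* Let $\alpha>0$, let $F$ be the distribution function of a positive random variable $X$ with $m(\alpha)=E(X^\alpha)<\infty$, assume that $F$ has a density $f$, and let $R(x)=\sum_{n=0}^{\infty}F^{\boxtimes n}(x)$ be the Kendall renewal function of $F$. Suppose that $f\in\Gamma(g)$. Then $$\lim_{x\to\infty}\frac{1}{x^{2\alpha-1}\overline{F}(x)}\left(R'(x)-\frac{2\alpha x^{\alpha-1}}{m(\alpha)}-\frac{x^{2\alpha}f(x)}{m^{2}(\alpha)}\right)=-\frac{4\alpha}{m^{2}(\alpha)},$$ and $$\lim_{x\to\infty}\frac{m^{2}(\alpha)}{x^{2\alpha}f(x)}\left(R'(x)-\frac{2\alpha x^{\alpha-1}}{m(\alpha)}\right)=1.$$
   Context: Fix $\alpha>0$. $X$ is a positive random variable with distribution function $F(x)=P(X\le x)$, $F(0-)=0$, $F$ continuous; $\overline{F}=1-F$; $m(\alpha)=\int_0^\infty y^\alpha\,dF(y)$; $m^2(\alpha)$ means $(m(\alpha))^2$. The Williamson transform ($G$-transform) of a distribution function $F$ with $F(0-)=0$ is $G_F(x)=\int_0^x\bigl(1-(t/x)^\alpha\bigr)\,dF(t)$, $x>0$. The Kendall convolution $F_1\boxtimes F_2$ of two distribution functions with $F_i(0-)=0$ is the distribution function $F_3$ (with $F_3(0-)=0$) determined by $G_{F_3}(x)=G_{F_1}(x)G_{F_2}(x)$. The $n$-fold Kendall convolution $F^{\boxtimes n}$ is thus the distribution function with $G$-transform $G_F^n$, and $F^{\boxtimes 0}$ is the distribution function of the point mass at $0$. $R'$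 is the derivative of $R$, understood at points $x$ where $F'(x)=f(x)$. A positive measurable function $f$ is in the class $\Gamma(g)$ with (positive, measurable) auxiliary function $g$ if $\lim_{x\to\infty}f(x+tg(x))/f(x)=e^{-t}$ for all real $t$; here $g$ is self-neglecting, i.e. $\lim_{x\to\infty}g(x+tg(x))/g(x)=1$ for all real $t$, and satisfies $\lim_{x\to\infty}g(x)/x=0$. *)

theory Defs
  imports "HOL-Probability.Probability"
begin

definition nonneg_distribution_function :: "(real \<Rightarrow> real) \<Rightarrow> bool" where
  "nonneg_distribution_function F \<longleftrightarrow>
     (\<exists>\<mu>. real_distribution \<mu> \<and> F = cdf \<mu>) \<and> (F \<longlongrightarrow> 0) (at_left 0)"

text \<open>The integration range is the closed interval, so that an atom of \<open>F\<close> at 0 is counted;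
  in particular the point mass at 0 has transform 1, the neutral element.\<close>

definition williamson_transform :: "real \<Rightarrow> (real \<Rightarrow> real) \<Rightarrow> real \<Rightarrow> real" where
  "williamson_transform \<alpha> F x =
     (LINT t:{0..x}|interval_measure F. 1 - (t / x) powr \<alpha>)"

definition kendall_conv :: "real \<Rightarrow> (real \<Rightarrow> real) \<Rightarrow> (real \<Rightarrow> real) \<Rightarrow> (real \<Rightarrow> real)" where
  "kendall_conv \<alpha> F1 F2 =
     (THE F3. nonneg_distribution_function F3 \<and>
        (\<forall>x>0. williamson_transform \<alpha> F3 x =
                williamson_transform \<alpha> F1 x * williamson_transform \<alpha> F2 x))"

primrec kendall_power :: "real \<Rightarrow> (real \<Rightarrow> real) \<Rightarrow> nat \<Rightarrow> (real \<Rightarrow> real)" where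
  "kendall_power \<alpha> F 0 = cdf (return borel 0)"
| "kendall_power \<alpha> F (Suc n) = kendall_conv \<alpha> F (kendall_power \<alpha> F n)"

definition kendall_renewal :: "real \<Rightarrow> (real \<Rightarrow> real) \<Rightarrow> real \<Rightarrow> real" where
  "kendall_renewal \<alpha> F x = (\<Sum>n. kendall_power \<alpha> F n x)"

definition self_neglecting :: "(real \<Rightarrow> real) \<Rightarrow> bool" where
  "self_neglecting g \<longleftrightarrow>
     (\<forall>t. ((\<lambda>x. g (x + t * g x) / g x) \<longlongrightarrow> 1) at_top)"

text \<open>Positivity is only required for all large arguments: a density of a positive random
  variable cannot be positive on the whole real line, and only the behaviour at infinity
  enters the limits.\<close>

definition class_Gamma :: "(real \<Rightarrow> real) \<Rightarrow> (real \<Rightarrow> real) set" where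
  "class_Gamma g =
     {f. f \<in> borel_measurable borel \<and> (\<forall>\<^sub>F x in at_top. 0 < f x) \<and>
         g \<in> borel_measurable borel \<and> (\<forall>\<^sub>F x in at_top. 0 < g x) \<and>
         self_neglecting g \<and> ((\<lambda>x. g x / x) \<longlongrightarrow> 0) at_top \<and>
         (\<forall>t. ((\<lambda>x. f (x + t * g x) / f x) \<longlongrightarrow> exp (- t)) at_top)}"

text \<open>A density \<open>f\<close> is the derivative of \<open>F\<close> only almost everywhere, so \<open>x\<close> tends
  to infinity through the points with \<open>F'(x) = f(x)\<close>.\<close>

definition at_top_density_points :: "(real \<Rightarrow> real) \<Rightarrow> (real \<Rightarrow> real) \<Rightarrow> real filter" where
  "at_top_density_points F f =
     inf at_top (principal {x. (F has_real_derivative f x) (at x)})"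

end

theory Submission
  imports Defs
begin

text \<open>
  Write \<open>G\<close> for the Williamson transform of \<open>F\<close> and \<open>a = 1 - F\<close>. Since \<open>x powr \<alpha> * G x\<close> is the mean of the
  positive part of \<open>x powr \<alpha> - X powr \<alpha>\<close>, its derivative is \<open>\<alpha> * x powr (\<alpha> - 1) * F x\<close>, that is,
  \<open>F = G + (x / \<alpha>) * G'\<close>. The same inversion applied to \<open>G ^ n\<close> shows that the \<open>n\<close>-th Kendall power of
  \<open>F\<close> is \<open>n * G ^ (n - 1) * F - (n - 1) * G ^ n\<close> (\<open>kendall_power_Suc\<close>), and the geometric series
  gives \<open>R = (1 - 2 * G + F) / (1 - G)\<^sup>2\<close> (\<open>kendall_renewal_eq\<close>). With the truncated moment
  \<open>w = x powr \<alpha> * (1 - G)\<close>, at every point where \<open>F' = f\<close>,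

  \<open>R' = x powr (2 * \<alpha>) * f / w\<^sup>2 + 2 * \<alpha> * x powr (\<alpha> - 1) * (w - x powr \<alpha> * a)\<^sup>2 / w ^ 3\<close>.

  Here \<open>w\<close> tends to \<open>m\<close>, and \<open>e = m - w\<close> is the integral of \<open>\<alpha> * u powr (\<alpha> - 1) * a u\<close> over \<open>u \<ge> x\<close>.
  Expanding the square, the cross term \<open>- 2 * w * x powr \<alpha> * a\<close> produces the constant
  \<open>- 4 * \<alpha> / m\<^sup>2\<close>; all other contributions to the first limit vanish once \<open>x powr \<alpha> * a\<close>,
  \<open>e / (x powr \<alpha> * a)\<close> and \<open>x * f * e / a\<close> tend to 0. The second limit follows from the first because
  \<open>a / (x * f)\<close> tends to 0 as well.

  The first of these relations holds because the moment of order \<open>\<alpha>\<close> is finite. The others come from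
  the class Gamma: the tail integral of a function \<open>h\<close> in the class has the order of \<open>g * h\<close>
  (\<open>class_Gamma_tail_integral\<close>), and the product of \<open>g * h\<close> with any power of \<open>x\<close> is again in the
  class. Hence \<open>a\<close> has the order of \<open>g * f\<close>, and \<open>e\<close> is at most of the order of
  \<open>x powr (\<alpha> - 1) * g\<^sup>2 * f\<close>, and it remains to use that \<open>g / x\<close> tends to 0.

  The tail estimate needs the limits that define the class, and the limit that makes \<open>g\<close>
  self-neglecting, uniformly for \<open>t\<close> in a compact set, whereas they are assumed for each \<open>t\<close>
  separately. For Borel functions pointwise convergence is enough: by the Baire category theorem
  the limits are uniform on a comeager set of parameters in some interval, and affine images of such
  sets meet (\<open>exists_close_increment\<close>, \<open>ln_scale_uniform\<close>, \<open>uniform_increment\<close>).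
\<close>

section \<open>Meager sets and the Baire property\<close>

definition meager :: "'a::topological_space set \<Rightarrow> bool" where
  "meager A \<longleftrightarrow>
     (\<exists>\<C>. countable \<C> \<and> (\<forall>C\<in>\<C>. closed C \<and> interior C = {}) \<and> A \<subseteq> \<Union>\<C>)"

lemma meager_subset: "meager B \<Longrightarrow> A \<subseteq> B \<Longrightarrow> meager A"
  unfolding meager_def by (meson order_trans)

lemma meager_closed: "closed C \<Longrightarrow> interior C = {} \<Longrightarrow> meager C"
  unfolding meager_def by (intro exI[of _ "{C}"]) auto

lemma meager_empty: "meager {}"
  by (rule meager_closed) auto

lemma meager_UN:
  assumes "countable I" "\<And>i. i \<in> I \<Longrightarrow> meager (A i)"
  shows "meager (\<Union>i\<in>I. A i)"
proof -
  have "\<forall>i\<in>I. \<exists>\<C>. countable \<C> \<and> (\<forall>C\<in>\<C>. closed C \<and> interior C = {}) \<and> A i \<subseteq> \<Union>\<C>"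
    using assms(2) unfolding meager_def by blast
  then obtain \<C> where \<C>: "\<forall>i\<in>I. countable (\<C> i) \<and> (\<forall>C\<in>\<C> i. closed C \<and> interior C = {}) \<and> A i \<subseteq> \<Union>(\<C> i)"
    by metis
  let ?D = "\<Union>i\<in>I. \<C> i"
  have "countable ?D"
    using \<C> assms(1) by (intro countable_UN) auto
  moreover have "\<forall>C\<in>?D. closed C \<and> interior C = {}"
    using \<C> by auto
  moreover have "(\<Union>i\<in>I. A i) \<subseteq> \<Union>?D"
    using \<C> by fastforce
  ultimately show ?thesis
    unfolding meager_def by (meson order_trans)
qed

lemma meager_Un: "meager A \<Longrightarrow> meager B \<Longrightarrow> meager (A \<union> B)"
  using meager_UN[of "{True, False}" "\<lambda>b. if b then A else B"]
  by (auto simp: Un_commute)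

lemma not_meager_open:
  fixes U :: "'a::euclidean_space set"
  assumes "open U" "U \<noteq> {}"
  shows "\<not> meager U"
proof
  assume "meager U"
  then obtain \<C> where \<C>: "countable \<C>" "\<And>C. C \<in> \<C> \<Longrightarrow> closed C \<and> interior C = {}" "U \<subseteq> \<Union>\<C>"
    unfolding meager_def by (meson order_trans)
  have "euclidean interior_of \<Union>\<C> = {}"
    by (rule Baire_category_alt) (use \<C> in \<open>auto simp: completely_metrizable_space_euclidean\<close>)
  moreover have "U \<subseteq> interior (\<Union>\<C>)"
    using \<C>(3) assms(1) by (simp add: interior_maximal)
  ultimately show False
    using assms(2) by simp
qed

lemma meager_affine_vimage:
  fixes A :: "real set"
  assumes "meager A" "k \<noteq> 0"
  shows "meager ((\<lambda>s. k * s + l) -` A)"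
proof -
  obtain \<C> where \<C>: "countable \<C>" "\<And>C. C \<in> \<C> \<Longrightarrow> closed C \<and> interior C = {}" "A \<subseteq> \<Union>\<C>"
    using assms(1) unfolding meager_def by blast
  let ?w = "\<lambda>s. k * s + l"
  have "closed (?w -` C) \<and> interior (?w -` C) = {}" if "C \<in> \<C>" for C
  proof
    show "closed (?w -` C)"
      using \<C>(2)[OF that] by (intro continuous_closed_vimage) auto
    have inv: "(?w s - l) / k = s" "?w ((s - l) / k) = s" for s
      using assms(2) by (simp_all add: field_simps)
    have *: "?w ` interior (?w -` C) = (\<lambda>s. (s - l) / k) -` interior (?w -` C)"
      by (auto simp only: vimage_def image_def mem_Collect_eq inv) (metis inv(2))
    have "open (?w ` interior (?w -` C))"
      unfolding * using assms(2) by (intro continuous_open_vimage) (auto intro!: continuous_intros)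
    moreover have "?w ` interior (?w -` C) \<subseteq> C"
      using interior_subset[of "?w -` C"] by auto
    ultimately have "?w ` interior (?w -` C) \<subseteq> interior C"
      by (rule interior_maximal[rotated])
    then show "interior (?w -` C) = {}"
      using \<C>(2)[OF that] by auto
  qed
  then have "\<forall>C\<in>(\<lambda>C. ?w -` C) ` \<C>. closed C \<and> interior C = {}"
    by simp
  moreover have "?w -` A \<subseteq> \<Union>((\<lambda>C. ?w -` C) ` \<C>)"
    using \<C>(3) by (simp add: vimage_UN[symmetric] vimage_mono)
  moreover have "countable ((\<lambda>C. ?w -` C) ` \<C>)"
    using \<C>(1) by simp
  ultimately show ?thesis
    unfolding meager_def by meson
qed

text \<open>The sets with this property form a \<open>\<sigma>\<close>-algebra containing the open sets. For complements
  one replaces \<open>U\<close> by the complement of its closure; the error \<open>closure U - U\<close> is closed with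
  empty interior.\<close>

lemma borel_baire_property:
  assumes "A \<in> sets (borel :: 'a::topological_space measure)"
  shows "\<exists>U. open U \<and> meager (A - U) \<and> meager (U - A)"
proof -
  from assms have "A \<in> sigma_sets UNIV {S :: 'a set. open S}"
    by (simp add: borel_def)
  then show ?thesis
  proof induction
    case (Basic a)
    then show ?case by (intro exI[of _ a]) (auto simp: meager_empty)
  next
    case Empty
    then show ?case by (intro exI[of _ "{}"]) (auto simp: meager_empty)
  next
    case (Compl a)
    then obtain U where U: "open U" "meager (a - U)" "meager (U - a)" by blast
    have "meager (closure U - U)"
    proof (rule meager_closed)
      show "closed (closure U - U)"
        using U(1) by (simp add: closed_Diff)
      have "interior (closure U - U) \<inter> U = {}"
        using interior_subset[of "closure U - U"] by blast
      then have "interior (closure U - U) \<inter> closure U = {}"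
        by (simp add: open_Int_closure_eq_empty)
      then show "interior (closure U - U) = {}"
        using interior_subset by fastforce
    qed
    have "meager ((- a) - (- closure U))"
      by (rule meager_subset[OF meager_Un[OF U(3) \<open>meager (closure U - U)\<close>]]) auto
    moreover have "meager ((- closure U) - (- a))"
      by (rule meager_subset[OF U(2)]) (use closure_subset[of U] in auto)
    moreover have "open (- closure U)"
      by auto
    ultimately show ?case
      unfolding Compl_eq_Diff_UNIV[symmetric] by blast
  next
    case (Union a)
    then obtain U where U: "\<And>i. open (U i) \<and> meager (a i - U i) \<and> meager (U i - a i)" by metis
    have *: "meager (\<Union>i::nat. a i - U i)" "meager (\<Union>i::nat. U i - a i)"
      using U by (auto intro!: meager_UN)
    have "meager ((\<Union>i. a i) - (\<Union>i. U i))"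
      by (rule meager_subset[OF *(1)]) auto
    moreover have "meager ((\<Union>i. U i) - (\<Union>i. a i))"
      by (rule meager_subset[OF *(2)]) auto
    moreover have "open (\<Union>i. U i)"
      using U by auto
    ultimately show ?case by blast
  qed
qed

text \<open>This is the form in which Baire category is used below: \<open>T n\<close> will be the set of parameters for
  which a pointwise convergence is already accurate from stage \<open>n\<close> on. In contrast to Egorov's
  theorem the exceptional set is small in every subinterval, however short, and this survives an
  affine rescaling of the parameter by an arbitrarily small factor.\<close>

lemma comeager_in_interval:
  fixes T :: "nat \<Rightarrow> real set"
  assumes "\<And>n. T n \<in> sets borel" "(\<Union>n. T n) = UNIV"
  obtains N a b where "a < b" "meager ({a<..<b} - T N)"
proof -
  have "\<not> meager (\<Union>n. T n)"
    unfolding assms(2) by (rule not_meager_open) auto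
  then obtain N where N: "\<not> meager (T N)"
    using meager_UN[of UNIV T] by auto
  obtain U where U: "open U" "meager (T N - U)" "meager (U - T N)"
    using borel_baire_property[OF assms(1)] by blast
  have "U \<noteq> {}" using N U(2) by auto
  then obtain u where u: "u \<in> U" by blast
  obtain e where e: "e > 0" "ball u e \<subseteq> U"
    using U(1) u openE by blast
  have "{u-e<..<u+e} \<subseteq> U"
    using e(2) by (simp add: ball_eq_greaterThanLessThan)
  then have "meager ({u-e<..<u+e} - T N)"
    by (intro meager_subset[OF U(3)]) auto
  then show ?thesis using e(1) by (intro that[of "u-e" "u+e"]) auto
qed

section \<open>Uniform convergence along a self-neglecting scale\<close>

locale self_neglecting_scale =
  fixes g :: "real \<Rightarrow> real"
  assumes g_borel: "g \<in> borel_measurable borel"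
    and g_pos: "\<forall>\<^sub>F x in at_top. 0 < g x"
    and g_self_neglecting: "self_neglecting g"
    and g_small: "((\<lambda>x. g x / x) \<longlongrightarrow> 0) at_top"
begin

lemma eventually_shift_ge_half:
  "\<forall>\<^sub>F x in at_top. \<forall>t. \<bar>t\<bar> \<le> C \<longrightarrow> x / 2 \<le> x + t * g x"
proof -
  have "\<forall>\<^sub>F x in at_top. g x / x < 1 / (2 * (\<bar>C\<bar> + 1))"
    using order_tendstoD(2)[OF g_small, of "1 / (2 * (\<bar>C\<bar> + 1))"] by simp
  then show ?thesis
    using g_pos eventually_gt_at_top[of 0]
  proof eventually_elim
    case (elim x)
    show ?case
    proof (intro allI impI)
      fix t assume t: "\<bar>t\<bar> \<le> C"
      have "\<bar>t\<bar> * g x \<le> (\<bar>C\<bar> + 1) * g x"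
        using t elim by (intro mult_right_mono) auto
      also have "\<dots> \<le> x / 2"
        using elim by (simp add: field_simps)
      finally have "\<bar>t * g x\<bar> \<le> x / 2"
        using elim by (simp add: abs_mult)
      then show "x / 2 \<le> x + t * g x" by linarith
    qed
  qed
qed

lemma eventually_shift:
  assumes "eventually P at_top"
  shows "\<forall>\<^sub>F x in at_top. \<forall>t. \<bar>t\<bar> \<le> C \<longrightarrow> P (x + t * g x)"
proof -
  obtain X where X: "\<And>x. x \<ge> X \<Longrightarrow> P x"
    using assms unfolding eventually_at_top_linorder by blast
  show ?thesis
    using eventually_shift_ge_half[of C] eventually_ge_at_top[of "2 * X"]
  proof eventually_elim
    case (elim x)
    show ?case
    proof (intro allI impI)
      fix t assume "\<bar>t\<bar> \<le> C"
      then have "x / 2 \<le> x + t * g x" using elim by blast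
      then show "P (x + t * g x)" using elim X by simp
    qed
  qed
qed

lemma ln_scale_shift: "((\<lambda>x. ln (g (x + t * g x)) - ln (g x)) \<longlongrightarrow> 0) at_top"
proof -
  have "((\<lambda>x. ln (g (x + t * g x) / g x)) \<longlongrightarrow> ln 1) at_top"
    using g_self_neglecting unfolding self_neglecting_def by (intro tendsto_ln) auto
  moreover have "\<forall>\<^sub>F x in at_top. ln (g (x + t * g x) / g x) = ln (g (x + t * g x)) - ln (g x)"
    using eventually_shift[OF g_pos, of "\<bar>t\<bar>"] g_pos
    by eventually_elim (auto simp: ln_div)
  ultimately show ?thesis
    by (simp add: tendsto_cong)
qed

text \<open>Two points \<open>x\<close> and \<open>y = x + t * g x\<close> look at a common third point, from \<open>y\<close> as
  \<open>y + s * g y\<close> and from \<open>z = x + q * g x\<close> as \<open>z + w * g z\<close>. If both pointwise limits are accurate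
  there, the increment of \<open>\<phi>\<close> from \<open>x\<close> to \<open>y\<close> is controlled. The admissible parameters \<open>s\<close> and \<open>w\<close>
  are comeager in one interval, and \<open>w\<close> is an affine function of \<open>s\<close>, so a common point exists
  even if the ratio \<open>g y / g x\<close> tends to 0. The auxiliary rational \<open>q\<close> is needed because that
  interval is not under control: \<open>q\<close> moves the parameter \<open>w\<close> into it. Only countably many base
  points occur, so the sets of good parameters are Borel.

  The drift cancels from the comparison only if \<open>g y / g x\<close> tends to 1 or if there is no drift;
  the second case serves for \<open>\<phi> = ln g\<close>, where nothing is known yet about the ratio.\<close>

lemma exists_close_increment:
  assumes \<phi>_borel: "\<phi> \<in> borel_measurable borel"
    and \<phi>: "\<And>t. ((\<lambda>x. \<phi> (x + t * g x) - \<phi> x) \<longlongrightarrow> c * t) at_top"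
    and x: "filterlim x at_top sequentially"
    and t: "t \<longlonglongrightarrow> t0"
    and y: "\<And>n. y n = x n + t n * g (x n)"
    and \<rho>: "(\<lambda>n. g (y n) / g (x n)) \<longlonglongrightarrow> \<rho>"
    and c: "c = 0 \<or> \<rho> = 1"
    and "\<epsilon> > 0"
  shows "\<exists>n. \<bar>\<phi> (y n) - \<phi> (x n) - c * t n\<bar> \<le> 4 * \<epsilon>"
proof -
  define Z where "Z = (\<lambda>(n, q). x n + q * g (x n)) ` (UNIV \<times> \<rat>) \<union> range y"
  define T where "T N = {w. \<forall>z\<in>Z. z \<ge> real N \<longrightarrow> \<bar>\<phi> (z + w * g z) - \<phi> z - c * w\<bar> \<le> \<epsilon>}" for N
  have "countable Z"
    unfolding Z_def by (intro countable_Un countable_image countable_SIGMA) (auto simp: countable_rat)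
  have "T N \<in> sets borel" for N
  proof -
    have "T N = (\<Inter>z\<in>{z\<in>Z. z \<ge> real N}. {w. \<bar>\<phi> (z + w * g z) - \<phi> z - c * w\<bar> \<le> \<epsilon>})"
      unfolding T_def by auto
    moreover have "{w. \<bar>\<phi> (z + w * g z) - \<phi> z - c * w\<bar> \<le> \<epsilon>} \<in> sets borel" for z
    proof -
      have [measurable]: "(\<lambda>w. \<phi> (z + w * g z)) \<in> borel_measurable borel"
        using \<phi>_borel by (rule measurable_compose[rotated]) measurable
      show ?thesis by measurable
    qed
    moreover have "countable {z\<in>Z. z \<ge> real N}"
      using \<open>countable Z\<close> by (rule countable_subset[rotated]) auto
    ultimately show ?thesis
      by (simp only:) (rule sets.countable_INT''[OF _ _ \<open>\<And>z. {w. \<bar>\<phi> (z + w * g z) - \<phi> z - c * w\<bar> \<le> \<epsilon>} \<in> sets borel\<close>], auto)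
  qed
  moreover have "(\<Union>N. T N) = UNIV"
  proof -
    have "\<exists>N. w \<in> T N" for w
    proof -
      have "\<forall>\<^sub>F z in at_top. dist (\<phi> (z + w * g z) - \<phi> z) (c * w) < \<epsilon>"
        using \<phi>[of w] \<open>\<epsilon> > 0\<close> by (rule tendstoD)
      then obtain X where X: "\<And>z. z \<ge> X \<Longrightarrow> dist (\<phi> (z + w * g z) - \<phi> z) (c * w) < \<epsilon>"
        unfolding eventually_at_top_linorder by blast
      obtain N where "X \<le> real N" using real_arch_simple by blast
      then have "w \<in> T N"
        unfolding T_def using X by (fastforce simp: dist_real_def intro: less_imp_le order_trans)
      then show ?thesis ..
    qed
    then show ?thesis by auto
  qed
  ultimately obtain N a b where ab: "a < b" and comeager: "meager ({a<..<b} - T N)"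
    by (rule comeager_in_interval)

  \<comment> \<open>The base point is moved from \<open>x n\<close> to \<open>z n\<close> so that both views see the same piece of
    the line through parameters in \<open>{a<..<b}\<close>.\<close>
  define s0 where "s0 = (a + b) / 2"
  obtain q where q: "q \<in> \<rat>" "t0 + s0 * \<rho> - b < q" "q < t0 + s0 * \<rho> - a"
    using Rats_dense_in_real[of "t0 + s0 * \<rho> - b" "t0 + s0 * \<rho> - a"] ab by auto
  define z where "z n = x n + q * g (x n)" for n
  define r where "r n = g (z n) / g (x n)" for n
  define w where "w n s = (t n - q + s * (g (y n) / g (x n))) / r n" for n s
  define B where "B = \<bar>a\<bar> + \<bar>b\<bar>"

  have "Bseq t" using t convergent_imp_Bseq convergent_def by blast
  then obtain C where C: "\<And>n. \<bar>t n\<bar> \<le> C"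
    unfolding Bseq_def by auto
  note at_x = filterlim_iff[THEN iffD1, OF x, rule_format]
  have gx: "\<forall>\<^sub>F n in sequentially. 0 < g (x n)"
    using at_x[OF g_pos] .
  have gz: "\<forall>\<^sub>F n in sequentially. 0 < g (z n) \<and> z n \<ge> N"
    using at_x[OF eventually_shift[OF eventually_conj[OF g_pos eventually_ge_at_top[of "real N"]], of "\<bar>q\<bar>"]]
    by eventually_elim (auto simp: z_def)
  have gy: "\<forall>\<^sub>F n in sequentially. 0 < g (y n) \<and> y n \<ge> N"
    using at_x[OF eventually_shift[OF eventually_conj[OF g_pos eventually_ge_at_top[of "real N"]], of C]]
    by eventually_elim (use C in \<open>auto simp: y\<close>)
  have r: "r \<longlonglongrightarrow> 1"
    using g_self_neglecting filterlim_compose[OF _ x] unfolding self_neglecting_def r_def z_def by blast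
  have \<phi>z: "\<forall>\<^sub>F n in sequentially. \<bar>\<phi> (z n) - \<phi> (x n) - c * q\<bar> < \<epsilon>"
    using tendstoD[OF filterlim_compose[OF \<phi>[of q] x] \<open>\<epsilon> > 0\<close>]
    by (simp add: z_def dist_real_def)
  have ws0: "(\<lambda>n. w n s0) \<longlonglongrightarrow> (t0 - q + s0 * \<rho>) / 1"
    unfolding w_def by (intro tendsto_intros t \<rho> r) auto
  have ws0_in: "\<forall>\<^sub>F n in sequentially. a < w n s0 \<and> w n s0 < b"
    using q by (intro eventually_conj order_tendstoD[OF ws0]) auto
  have drift: "\<forall>\<^sub>F n in sequentially. \<forall>s. a < s \<longrightarrow> s < b \<longrightarrow> \<bar>c * (w n s + q - s - t n)\<bar> \<le> \<epsilon>"
  proof (cases "c = 0")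
    case True
    then show ?thesis using \<open>\<epsilon> > 0\<close> by simp
  next
    case False
    then have "\<rho> = 1" using c by simp
    define E where "E n = \<bar>t n - q\<bar> * \<bar>1 / r n - 1\<bar> + B * \<bar>g (y n) / g (x n) / r n - 1\<bar>" for n
    have "E \<longlonglongrightarrow> \<bar>t0 - q\<bar> * \<bar>1 / 1 - 1\<bar> + B * \<bar>1 / 1 - 1\<bar>"
      unfolding E_def by (intro tendsto_intros t r \<rho>[unfolded \<open>\<rho> = 1\<close>]) auto
    then have "\<forall>\<^sub>F n in sequentially. E n < \<epsilon> / \<bar>c\<bar>"
      using False \<open>\<epsilon> > 0\<close> by (intro order_tendstoD(2)) auto
    then show ?thesis
    proof eventually_elim
      case (elim n)
      show ?case
      proof (intro allI impI)
        fix s assume s: "a < s" "s < b"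
        have "w n s + q - s - t n = (t n - q) * (1 / r n - 1) + s * (g (y n) / g (x n) / r n - 1)"
          unfolding w_def by (simp add: algebra_simps add_divide_distrib diff_divide_distrib)
        then have "\<bar>w n s + q - s - t n\<bar> \<le> \<bar>t n - q\<bar> * \<bar>1 / r n - 1\<bar> + \<bar>s\<bar> * \<bar>g (y n) / g (x n) / r n - 1\<bar>"
          by (metis abs_mult abs_triangle_ineq)
        also have "\<dots> \<le> E n"
          unfolding E_def B_def using s by (intro add_left_mono mult_right_mono) auto
        finally have "\<bar>c\<bar> * \<bar>w n s + q - s - t n\<bar> \<le> \<bar>c\<bar> * (\<epsilon> / \<bar>c\<bar>)"
          using elim by (intro mult_left_mono) auto
        then show "\<bar>c * (w n s + q - s - t n)\<bar> \<le> \<epsilon>"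
          using False by (simp add: abs_mult)
      qed
    qed
  qed
  have "\<forall>\<^sub>F n in sequentially. \<bar>\<phi> (y n) - \<phi> (x n) - c * t n\<bar> \<le> 4 * \<epsilon>"
    using gx gy gz \<phi>z ws0_in drift
  proof eventually_elim
    case (elim n)
    have rn: "r n > 0" unfolding r_def using elim by simp
    define k where "k = g (y n) / g (x n) / r n"
    define l where "l = (t n - q) / r n"
    have w: "w n s = k * s + l" for s
      unfolding w_def k_def l_def by (simp add: add_divide_distrib)
    have "k \<noteq> 0" unfolding k_def using elim rn by auto
    define V where "V = {s. a < s \<and> s < b \<and> a < w n s \<and> w n s < b}"
    have "open V"
      unfolding V_def w by (intro open_Collect_conj open_Collect_less continuous_intros)
    moreover have "s0 \<in> V"
      unfolding V_def using elim ab by (auto simp: s0_def)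
    ultimately have "\<not> meager V"
      using not_meager_open by blast
    moreover have "meager (({a<..<b} - T N) \<union> ((\<lambda>s. k * s + l) -` ({a<..<b} - T N)))"
      by (intro meager_Un comeager meager_affine_vimage \<open>k \<noteq> 0\<close>)
    ultimately have "\<not> V \<subseteq> ({a<..<b} - T N) \<union> ((\<lambda>s. k * s + l) -` ({a<..<b} - T N))"
      by (meson meager_subset)
    then obtain s where s: "s \<in> V" "s \<notin> {a<..<b} - T N" "w n s \<notin> {a<..<b} - T N"
      unfolding w by blast
    have "s \<in> T N" "w n s \<in> T N" "a < s" "s < b"
      using s unfolding V_def by auto
    have "y n \<in> Z" "z n \<in> Z"
      unfolding Z_def z_def using q(1) by (auto intro!: image_eqI[of _ _ "(n, q)"])
    then have 1: "\<bar>\<phi> (y n + s * g (y n)) - \<phi> (y n) - c * s\<bar> \<le> \<epsilon>"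
        "\<bar>\<phi> (z n + w n s * g (z n)) - \<phi> (z n) - c * w n s\<bar> \<le> \<epsilon>"
      using \<open>s \<in> T N\<close> \<open>w n s \<in> T N\<close> elim unfolding T_def by auto
    have "w n s * g (z n) = (t n - q + s * (g (y n) / g (x n))) * g (x n)"
      unfolding w_def r_def using elim by simp
    also have "\<dots> = t n * g (x n) - q * g (x n) + s * g (y n)"
      using elim by (simp add: algebra_simps)
    finally have 2: "z n + w n s * g (z n) = y n + s * g (y n)"
      unfolding z_def y by simp
    have "\<bar>c * (w n s + q - s - t n)\<bar> \<le> \<epsilon>"
      using elim \<open>a < s\<close> \<open>s < b\<close> by blast
    then have "\<bar>c * w n s + c * q - c * s - c * t n\<bar> \<le> \<epsilon>"
      by (simp add: algebra_simps)
    with 1 elim(4) show ?case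
      unfolding 2 abs_le_iff abs_less_iff by linarith
  qed
  then show ?thesis
    by (rule eventually_happens'[rotated]) simp
qed

text \<open>A violation of the lower bound makes the ratio of the two scales less than 1. The ratios thus lie
  in a compact interval, and along a subsequence they converge, possibly to 0, as
  \<open>exists_close_increment\<close> requires. A violation of the corresponding upper bound would allow the ratios to tend to
  infinity.\<close>

lemma ln_scale_shift_ge:
  assumes "\<epsilon> > 0"
  shows "\<forall>\<^sub>F x in at_top. \<forall>t. \<bar>t\<bar> \<le> 1 \<longrightarrow> ln (g x) - \<epsilon> \<le> ln (g (x + t * g x))"
proof (rule ccontr)
  assume "\<not> ?thesis"
  then have freq: "\<exists>\<^sub>F x in at_top. \<exists>t. \<bar>t\<bar> \<le> 1 \<and> ln (g (x + t * g x)) < ln (g x) - \<epsilon>"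
    by (simp add: frequently_def not_less)
  have "\<exists>x t. x \<ge> real n \<and> 0 < g x \<and> 0 < g (x + t * g x) \<and> \<bar>t\<bar> \<le> 1 \<and>
      ln (g (x + t * g x)) < ln (g x) - \<epsilon>" for n :: nat
  proof -
    have "\<forall>\<^sub>F x in at_top. x \<ge> real n \<and> 0 < g x \<and> (\<forall>t. \<bar>t\<bar> \<le> 1 \<longrightarrow> 0 < g (x + t * g x))"
      using eventually_ge_at_top[of "real n"] g_pos eventually_shift[OF g_pos, of 1]
      by (simp add: eventually_conj_iff)
    from frequently_eventually_conj[OF freq this] show ?thesis
      by (blast dest!: frequently_ex)
  qed
  then obtain x t where xt: "\<And>n::nat. x n \<ge> real n \<and> 0 < g (x n) \<and> 0 < g (x n + t n * g (x n)) \<and>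
      \<bar>t n\<bar> \<le> 1 \<and> ln (g (x n + t n * g (x n))) < ln (g (x n)) - \<epsilon>"
    by metis
  define y where "y n = x n + t n * g (x n)" for n
  have "compact ({-1..1::real} \<times> {0..1::real})"
    by (intro compact_Times compact_Icc)
  moreover have "(t n, g (y n) / g (x n)) \<in> {-1..1} \<times> {0..1}" for n
  proof -
    have "ln (g (y n)) \<le> ln (g (x n))"
      using xt[of n] \<open>\<epsilon> > 0\<close> unfolding y_def by linarith
    then have "g (y n) \<le> g (x n)"
      using xt[of n] unfolding y_def by simp
    then show ?thesis
      using xt[of n] unfolding y_def by (auto simp: abs_le_iff)
  qed
  ultimately obtain p \<sigma> where \<sigma>: "strict_mono \<sigma>"
      and p: "((\<lambda>n. (t n, g (y n) / g (x n))) \<circ> \<sigma>) \<longlonglongrightarrow> p"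
    unfolding compact_def by meson
  have x_top: "filterlim (x \<circ> \<sigma>) at_top sequentially"
  proof -
    have "filterlim x at_top sequentially"
      using filterlim_real_sequentially
      by (rule filterlim_at_top_mono) (use xt in auto)
    then show ?thesis
      unfolding o_def by (rule filterlim_compose) (rule filterlim_subseq[OF \<sigma>])
  qed
  have "\<exists>n. \<bar>ln (g ((y \<circ> \<sigma>) n)) - ln (g ((x \<circ> \<sigma>) n)) - 0 * (t \<circ> \<sigma>) n\<bar> \<le> 4 * (\<epsilon> / 8)"
  proof (rule exists_close_increment[where \<phi> = "\<lambda>u. ln (g u)" and c = 0])
    show "(\<lambda>u. ln (g u)) \<in> borel_measurable borel"
      using g_borel by measurable
    show "((\<lambda>x. ln (g (x + t * g x)) - ln (g x)) \<longlongrightarrow> 0 * t) at_top" for t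
      using ln_scale_shift[of t] by simp
    show "filterlim (x \<circ> \<sigma>) at_top sequentially"
      by (rule x_top)
    show "(t \<circ> \<sigma>) \<longlonglongrightarrow> fst p"
      using tendsto_fst[OF p] by (simp add: o_def)
    show "(\<lambda>n. g ((y \<circ> \<sigma>) n) / g ((x \<circ> \<sigma>) n)) \<longlonglongrightarrow> snd p"
      using tendsto_snd[OF p] by (simp add: o_def)
  qed (use \<open>\<epsilon> > 0\<close> in \<open>auto simp: y_def\<close>)
  then obtain n where "\<bar>ln (g (y n)) - ln (g (x n))\<bar> \<le> \<epsilon> / 2"
    by auto
  then show False
    using xt[of n] \<open>\<epsilon> > 0\<close> unfolding y_def by linarith
qed

text \<open>If \<open>g y > g x\<close> for \<open>y = x + t * g x\<close>, then \<open>x\<close> is within one unit of \<open>y\<close> on the scale \<open>g y\<close>,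
  so the upper bound is the lower bound with the roles of \<open>x\<close> and \<open>y\<close> exchanged.\<close>

lemma ln_scale_uniform:
  assumes "\<epsilon> > 0"
  shows "\<forall>\<^sub>F x in at_top. \<forall>t. \<bar>t\<bar> \<le> 1 \<longrightarrow> \<bar>ln (g (x + t * g x)) - ln (g x)\<bar> \<le> \<epsilon>"
  using ln_scale_shift_ge[OF assms] eventually_shift[OF ln_scale_shift_ge[OF assms], of 1]
    g_pos eventually_shift[OF g_pos, of 1]
proof eventually_elim
  case (elim x)
  show ?case
  proof (intro allI impI)
    fix t :: real assume t: "\<bar>t\<bar> \<le> 1"
    define y where "y = x + t * g x"
    have pos: "0 < g x" "0 < g y" using elim t unfolding y_def by auto
    have lower: "ln (g x) - \<epsilon> \<le> ln (g y)"
      using elim(1) t unfolding y_def by blast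
    have "ln (g y) \<le> ln (g x) + \<epsilon>"
    proof (cases "g y \<le> g x")
      case True
      then have "ln (g y) \<le> ln (g x)" using pos by simp
      then show ?thesis using assms by simp
    next
      case False
      define s where "s = - (t * g x / g y)"
      have "\<bar>t\<bar> * g x \<le> 1 * g y"
        using False t pos by (intro mult_mono) auto
      then have "\<bar>s\<bar> \<le> 1"
        unfolding s_def using pos by (simp add: abs_mult abs_divide)
      moreover have "y + s * g y = x"
        unfolding s_def y_def using pos unfolding y_def by simp
      ultimately have "ln (g y) - \<epsilon> \<le> ln (g x)"
        using elim(2) t unfolding y_def by metis
      then show ?thesis by simp
    qed
    then show "\<bar>ln (g (x + t * g x)) - ln (g x)\<bar> \<le> \<epsilon>"
      using lower unfolding y_def by linarith
  qed
qed

lemma uniform_increment: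
  assumes \<phi>_borel: "\<phi> \<in> borel_measurable borel"
    and \<phi>: "\<And>t. ((\<lambda>x. \<phi> (x + t * g x) - \<phi> x) \<longlongrightarrow> c * t) at_top"
    and "\<epsilon> > 0"
  shows "\<forall>\<^sub>F x in at_top. \<forall>t. \<bar>t\<bar> \<le> 1 \<longrightarrow> \<bar>\<phi> (x + t * g x) - \<phi> x - c * t\<bar> \<le> \<epsilon>"
proof (rule ccontr)
  assume "\<not> ?thesis"
  then have freq: "\<exists>\<^sub>F x in at_top. \<exists>t. \<bar>t\<bar> \<le> 1 \<and> \<epsilon> < \<bar>\<phi> (x + t * g x) - \<phi> x - c * t\<bar>"
    by (simp add: frequently_def not_less)
  have "\<exists>x t. x \<ge> real n \<and> 0 < g x \<and> 0 < g (x + t * g x) \<and> \<bar>t\<bar> \<le> 1 \<and>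
      \<bar>ln (g (x + t * g x)) - ln (g x)\<bar> \<le> 1 / real (Suc n) \<and>
      \<epsilon> < \<bar>\<phi> (x + t * g x) - \<phi> x - c * t\<bar>" for n :: nat
  proof -
    have "\<forall>\<^sub>F x in at_top. x \<ge> real n \<and> 0 < g x \<and> (\<forall>t. \<bar>t\<bar> \<le> 1 \<longrightarrow> 0 < g (x + t * g x)) \<and>
       (\<forall>t. \<bar>t\<bar> \<le> 1 \<longrightarrow> \<bar>ln (g (x + t * g x)) - ln (g x)\<bar> \<le> 1 / real (Suc n))"
      using eventually_ge_at_top[of "real n"] g_pos eventually_shift[OF g_pos, of 1]
        ln_scale_uniform[of "1 / real (Suc n)"]
      by (simp add: eventually_conj_iff)
    from frequently_eventually_conj[OF freq this] show ?thesis
      by (blast dest!: frequently_ex)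
  qed
  then obtain x t where xt: "\<And>n::nat. x n \<ge> real n \<and> 0 < g (x n) \<and> 0 < g (x n + t n * g (x n)) \<and>
      \<bar>t n\<bar> \<le> 1 \<and> \<bar>ln (g (x n + t n * g (x n))) - ln (g (x n))\<bar> \<le> 1 / real (Suc n) \<and>
      \<epsilon> < \<bar>\<phi> (x n + t n * g (x n)) - \<phi> (x n) - c * t n\<bar>"
    by metis
  define y where "y n = x n + t n * g (x n)" for n
  have "compact {-1..1::real}" by (rule compact_Icc)
  moreover have "t n \<in> {-1..1}" for n
    using xt[of n] by (auto simp: abs_le_iff)
  ultimately obtain t0 \<sigma> where \<sigma>: "strict_mono \<sigma>" and t0: "(t \<circ> \<sigma>) \<longlonglongrightarrow> t0"
    unfolding compact_def by meson
  have x_top: "filterlim (x \<circ> \<sigma>) at_top sequentially"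
  proof -
    have "filterlim x at_top sequentially"
      using filterlim_real_sequentially
      by (rule filterlim_at_top_mono) (use xt in auto)
    then show ?thesis
      unfolding o_def by (rule filterlim_compose) (rule filterlim_subseq[OF \<sigma>])
  qed
  have "(\<lambda>n. g (y n) / g (x n)) \<longlonglongrightarrow> 1"
  proof -
    have "(\<lambda>n. ln (g (y n)) - ln (g (x n))) \<longlonglongrightarrow> 0"
      by (rule Lim_null_comparison[OF _ LIMSEQ_Suc[OF lim_1_over_n]])
        (use xt in \<open>auto simp: y_def\<close>)
    then have "(\<lambda>n. exp (ln (g (y n)) - ln (g (x n)))) \<longlonglongrightarrow> exp 0"
      by (rule tendsto_exp)
    moreover have "exp (ln (g (y n)) - ln (g (x n))) = g (y n) / g (x n)" for n
      using xt[of n] by (simp add: exp_diff y_def)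
    ultimately show ?thesis by simp
  qed
  then have ratio: "(\<lambda>n. g ((y \<circ> \<sigma>) n) / g ((x \<circ> \<sigma>) n)) \<longlonglongrightarrow> 1"
    using LIMSEQ_subseq_LIMSEQ[OF _ \<sigma>] by (fastforce simp: o_def)
  have "\<exists>n. \<bar>\<phi> ((y \<circ> \<sigma>) n) - \<phi> ((x \<circ> \<sigma>) n) - c * (t \<circ> \<sigma>) n\<bar> \<le> 4 * (\<epsilon> / 8)"
    by (rule exists_close_increment[OF \<phi>_borel \<phi> x_top t0 _ ratio]) (use \<open>\<epsilon> > 0\<close> in \<open>auto simp: y_def\<close>)
  then obtain n where "\<bar>\<phi> (y n) - \<phi> (x n) - c * t n\<bar> \<le> \<epsilon> / 2"
    by auto
  then show False
    using xt[of n] \<open>\<epsilon> > 0\<close> unfolding y_def by linarith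
qed

end

section \<open>Tail integrals in the class Gamma\<close>

lemma class_Gamma_scale: "f \<in> class_Gamma g \<Longrightarrow> self_neglecting_scale g"
  unfolding class_Gamma_def self_neglecting_scale_def by simp

text \<open>On the scale \<open>g\<close> the factors \<open>g\<close> and \<open>x powr \<beta>\<close> are asymptotically constant. Since \<open>g * f\<close> has the
  order of the tail integral of \<open>f\<close>, tail integrals of a function in the class are again of the
  order of a function in the class, and the estimate below can be iterated.\<close>

lemma class_Gamma_mult_scale:
  assumes "f \<in> class_Gamma g"
  shows "(\<lambda>x. x powr \<beta> * g x * f x) \<in> class_Gamma g"
proof -
  interpret self_neglecting_scale g
    using assms by (rule class_Gamma_scale)
  have f_borel: "f \<in> borel_measurable borel" and f_pos: "\<forall>\<^sub>F x in at_top. 0 < f x"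
    and f_lim: "\<And>t. ((\<lambda>x. f (x + t * g x) / f x) \<longlongrightarrow> exp (- t)) at_top"
    using assms unfolding class_Gamma_def by auto
  have "((\<lambda>x. ((x + t * g x) powr \<beta> * g (x + t * g x) * f (x + t * g x)) / (x powr \<beta> * g x * f x))
      \<longlongrightarrow> exp (- t)) at_top" for t
  proof -
    have "((\<lambda>x. (1 + t * (g x / x)) powr \<beta> * (g (x + t * g x) / g x) * (f (x + t * g x) / f x))
        \<longlongrightarrow> (1 + t * 0) powr \<beta> * 1 * exp (- t)) at_top"
      using g_self_neglecting unfolding self_neglecting_def
      by (intro tendsto_intros g_small f_lim) auto
    moreover have "\<forall>\<^sub>F x in at_top. (1 + t * (g x / x)) powr \<beta> * (g (x + t * g x) / g x) * (f (x + t * g x) / f x)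
      = ((x + t * g x) powr \<beta> * g (x + t * g x) * f (x + t * g x)) / (x powr \<beta> * g x * f x)"
      using eventually_gt_at_top[of 0] eventually_shift[OF eventually_gt_at_top[of 0], of "\<bar>t\<bar>"]
    proof eventually_elim
      case (elim x)
      have "1 + t * (g x / x) = (x + t * g x) / x"
        using elim by (simp add: field_simps)
      moreover have "x + t * g x \<ge> 0" using elim(2) by (meson less_imp_le order_refl)
      ultimately show ?case
        using elim(1) by (simp add: powr_divide)
    qed
    ultimately show ?thesis
      by (simp add: tendsto_cong)
  qed
  moreover have "\<forall>\<^sub>F x in at_top. 0 < x powr \<beta> * g x * f x"
    using f_pos g_pos eventually_gt_at_top[of 0] by eventually_elim simp
  ultimately show ?thesis
    using assms f_borel g_borel unfolding class_Gamma_def by auto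
qed

text \<open>Walk from \<open>x\<close> to infinity in steps of length \<open>g\<close>. By uniform convergence each step multiplies
  \<open>g * f\<close> by about \<open>exp (- 1)\<close>, certainly by at most 1/2, and over one step the integral of \<open>f\<close> is at
  most \<open>2 * (g * f)\<close> at its starting point; the geometric series gives the upper bound. The lower bound
  uses the first step alone. The tolerance 1/8 leaves room: \<open>exp (- 1 + 2/8) \<le> 1/2\<close> and
  \<open>1/4 \<le> exp (- 1 - 1/8)\<close>.\<close>

lemma class_Gamma_tail_integral:
  assumes "f \<in> class_Gamma g"
  shows "\<forall>\<^sub>F x in at_top.
    ennreal (g x * f x / 4) \<le> (\<integral>\<^sup>+y. ennreal (f y) * indicator {x..} y \<partial>lborel) \<and>
    (\<integral>\<^sup>+y. ennreal (f y) * indicator {x..} y \<partial>lborel) \<le> ennreal (4 * (g x * f x))"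
proof -
  interpret self_neglecting_scale g
    using assms by (rule class_Gamma_scale)
  have f_borel [measurable]: "f \<in> borel_measurable borel" and f_pos: "\<forall>\<^sub>F x in at_top. 0 < f x"
    and f_lim: "\<And>t. ((\<lambda>x. f (x + t * g x) / f x) \<longlongrightarrow> exp (- t)) at_top"
    using assms unfolding class_Gamma_def by auto
  have ln_lim: "((\<lambda>x. ln (f (x + t * g x)) - ln (f x)) \<longlongrightarrow> (- 1) * t) at_top" for t
  proof -
    have "((\<lambda>x. ln (f (x + t * g x) / f x)) \<longlongrightarrow> ln (exp (- t))) at_top"
      by (intro tendsto_ln f_lim) simp
    moreover have "\<forall>\<^sub>F x in at_top. ln (f (x + t * g x) / f x) = ln (f (x + t * g x)) - ln (f x)"
      using eventually_shift[OF f_pos, of "\<bar>t\<bar>"] f_pos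
      by eventually_elim (auto simp: ln_div)
    ultimately show ?thesis
      by (simp add: tendsto_cong)
  qed
  have "\<forall>\<^sub>F x in at_top. \<forall>t. \<bar>t\<bar> \<le> 1 \<longrightarrow> \<bar>ln (f (x + t * g x)) - ln (f x) - (- 1) * t\<bar> \<le> 1 / 8"
    by (rule uniform_increment[OF _ ln_lim]) auto
  moreover have "\<forall>\<^sub>F x in at_top. \<forall>t. \<bar>t\<bar> \<le> 1 \<longrightarrow> \<bar>ln (g (x + t * g x)) - ln (g x)\<bar> \<le> 1 / 8"
    by (rule ln_scale_uniform) simp
  ultimately have "\<forall>\<^sub>F x in at_top. 0 < f x \<and> 0 < g x \<and>
      (\<forall>t. \<bar>t\<bar> \<le> 1 \<longrightarrow> 0 < f (x + t * g x) \<and> \<bar>ln (f (x + t * g x)) - ln (f x) + t\<bar> \<le> 1 / 8) \<and>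
      (\<forall>t. \<bar>t\<bar> \<le> 1 \<longrightarrow> 0 < g (x + t * g x) \<and> \<bar>ln (g (x + t * g x)) - ln (g x)\<bar> \<le> 1 / 8)"
    using f_pos g_pos eventually_shift[OF f_pos, of 1] eventually_shift[OF g_pos, of 1]
    by eventually_elim simp
  then obtain X where X: "\<And>x. x \<ge> X \<Longrightarrow> 0 < f x \<and> 0 < g x"
    and Xf: "\<And>x t. x \<ge> X \<Longrightarrow> \<bar>t\<bar> \<le> 1 \<Longrightarrow> 0 < f (x + t * g x) \<and> \<bar>ln (f (x + t * g x)) - ln (f x) + t\<bar> \<le> 1 / 8"
    and Xg: "\<And>x t. x \<ge> X \<Longrightarrow> \<bar>t\<bar> \<le> 1 \<Longrightarrow> 0 < g (x + t * g x) \<and> \<bar>ln (g (x + t * g x)) - ln (g x)\<bar> \<le> 1 / 8"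
    unfolding eventually_at_top_linorder by blast
  have ln2: "2 / 3 \<le> ln (2::real)" "ln (2::real) \<le> 3 / 4"
    using ln2_ge_two_thirds ln2_le_25_over_36 by auto
  have f_upper: "f (x + t * g x) \<le> 2 * f x" if "x \<ge> X" "0 \<le> t" "t \<le> 1" for x t
  proof -
    have "ln (2 * f x) = ln 2 + ln (f x)"
      using X[of x] that by (simp add: ln_mult)
    then have "ln (f (x + t * g x)) \<le> ln (2 * f x)"
      using Xf[of x t] that ln2 by linarith
    then show ?thesis
      using Xf[of x t] X[of x] that by simp
  qed
  have f_lower: "f x / 4 \<le> f (x + t * g x)" if "x \<ge> X" "0 \<le> t" "t \<le> 1" for x t
  proof -
    have "ln (4::real) = 2 * ln 2"
      using ln_realpow[of "2::real" 2] by simp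
    then have "ln (f x / 4) = ln (f x) - 2 * ln 2"
      using X[of x] that by (simp add: ln_div)
    then have "ln (f x / 4) \<le> ln (f (x + t * g x))"
      using Xf[of x t] that ln2 by linarith
    then show ?thesis
      using Xf[of x t] X[of x] that by simp
  qed
  have g_lower: "g x / 2 \<le> g (x + t * g x)" if "x \<ge> X" "\<bar>t\<bar> \<le> 1" for x t
  proof -
    have "ln (g x / 2) = ln (g x) - ln 2"
      using X[of x] that by (simp add: ln_div)
    then have "ln (g x / 2) \<le> ln (g (x + t * g x))"
      using Xg[of x t] that ln2 by linarith
    then show ?thesis
      using Xg[of x t] X[of x] that by simp
  qed
  have halving: "g (x + g x) * f (x + g x) \<le> g x * f x / 2" if "x \<ge> X" for x
  proof -
    have "ln (g (x + g x) * f (x + g x)) = ln (g (x + g x)) + ln (f (x + g x))"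
      using Xf[of x 1] Xg[of x 1] that by (simp add: ln_mult)
    moreover have "ln (g x * f x / 2) = ln (g x) + ln (f x) - ln 2"
      using X[of x] that by (simp add: ln_div ln_mult)
    moreover have "\<bar>ln (f (x + g x)) - ln (f x) + 1\<bar> \<le> 1 / 8" "\<bar>ln (g (x + g x)) - ln (g x)\<bar> \<le> 1 / 8"
      using Xf[OF that, of 1] Xg[OF that, of 1] by simp_all
    ultimately have "ln (g (x + g x) * f (x + g x)) \<le> ln (g x * f x / 2)"
      using ln2 by linarith
    then show ?thesis
      using Xf[of x 1] Xg[of x 1] X[of x] that by simp
  qed

  show ?thesis
    using eventually_ge_at_top[of X]
  proof eventually_elim
    fix x assume x: "x \<ge> X"
    define I where "I A = (\<integral>\<^sup>+y. ennreal (f y) * indicator A y \<partial>lborel)" for A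
    define N where "N = density lborel (\<lambda>y. ennreal (f y))"
    have I_N: "I A = emeasure N A" if "A \<in> sets borel" for A
      unfolding I_def N_def using that by (simp add: emeasure_density)
    have [simp]: "sets N = sets borel" unfolding N_def by simp

    have "ennreal (g x * f x / 4) = (\<integral>\<^sup>+y. ennreal (f x / 4) * indicator {x..x + g x} y \<partial>lborel)"
      using X[OF x] by (simp add: nn_integral_cmult_indicator ennreal_mult'[symmetric] mult.commute)
    also have "\<dots> \<le> I {x..}"
      unfolding I_def
    proof (intro nn_integral_mono)
      fix y
      show "ennreal (f x / 4) * indicator {x..x + g x} y \<le> ennreal (f y) * indicator {x..} y"
        using f_lower[OF x, of "(y - x) / g x"] X[OF x]
        by (auto simp: indicator_def field_simps intro!: ennreal_leI)
    qed
    finally have lower: "ennreal (g x * f x / 4) \<le> I {x..}" .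

    define u where "u = rec_nat x (\<lambda>_ v. v + g v)"
    have u0: "u 0 = x" and uS: "u (Suc k) = u k + g (u k)" for k
      by (simp_all add: u_def)
    have u_ge: "u k \<ge> X" for k
    proof (induction k)
      case (Suc k)
      then show ?case using X[of "u k"] by (simp add: uS)
    qed (simp add: u0 x)
    have u_mono: "incseq u"
      using X[OF u_ge] by (intro incseq_SucI) (simp add: uS less_imp_le)
    \<comment> \<open>The walk cannot stop at a finite \<open>L\<close>: near \<open>L\<close> its steps have length at least \<open>g L / 2\<close>.\<close>
    have u_unbounded: "\<exists>k. y < u k" for y
    proof (rule ccontr)
      assume "\<not> ?thesis"
      then have "\<And>k. u k \<le> y" by (simp add: not_less)
      then obtain L where L: "u \<longlonglongrightarrow> L" "\<And>k. u k \<le> L"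
        using incseq_convergent[OF u_mono] by blast
      have "L \<ge> X" using L(2)[of 0] u_ge[of 0] by simp
      then have gL: "g L > 0" using X by blast
      have "(\<lambda>k. u (Suc k) - u k) \<longlonglongrightarrow> L - L"
        by (intro tendsto_diff LIMSEQ_Suc L)
      then have "\<forall>\<^sub>F k in sequentially. u (Suc k) - u k < g L / 2"
        using gL by (intro order_tendstoD(2)) auto
      moreover have "\<forall>\<^sub>F k in sequentially. L - g L < u k"
        using gL by (intro order_tendstoD(1)[OF L(1)]) auto
      ultimately have "\<forall>\<^sub>F k in sequentially. False"
      proof eventually_elim
        case (elim k)
        have "\<bar>(u k - L) / g L\<bar> \<le> 1"
          using elim(2) L(2)[of k] gL by (simp add: abs_if field_simps)
        from g_lower[OF \<open>L \<ge> X\<close> this] have "g L / 2 \<le> g (u k)"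
          using gL by simp
        then show False using elim(1) by (simp add: uS)
      qed
      then show False by simp
    qed
    have gf_u: "g (u k) * f (u k) \<le> g x * f x * (1/2) ^ k" for k
    proof (induction k)
      case (Suc k)
      then show ?case using halving[OF u_ge[of k]] by (simp add: uS)
    qed (simp add: u0)
    have cell: "I {u k..<u (Suc k)} \<le> ennreal (2 * (g x * f x) * (1/2) ^ k)" for k
    proof -
      have "I {u k..<u (Suc k)} \<le> (\<integral>\<^sup>+y. ennreal (2 * f (u k)) * indicator {u k..<u (Suc k)} y \<partial>lborel)"
        unfolding I_def
      proof (intro nn_integral_mono)
        fix y
        show "ennreal (f y) * indicator {u k..<u (Suc k)} y \<le> ennreal (2 * f (u k)) * indicator {u k..<u (Suc k)} y"
          using f_upper[OF u_ge[of k], of "(y - u k) / g (u k)"] X[OF u_ge[of k]]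
          by (auto simp: indicator_def field_simps uS intro!: ennreal_leI)
      qed
      also have "\<dots> = ennreal (2 * f (u k) * g (u k))"
        using X[OF u_ge[of k]]
        by (simp add: nn_integral_cmult_indicator uS ennreal_mult'[symmetric])
      also have "\<dots> \<le> ennreal (2 * (g x * f x) * (1/2) ^ k)"
        using gf_u[of k] by (intro ennreal_leI) (simp add: mult.commute mult.left_commute)
      finally show ?thesis .
    qed
    have partial: "I {x..<u n} \<le> ennreal (4 * (g x * f x) * (1 - (1/2) ^ n))" for n
    proof (induction n)
      case 0
      then show ?case by (simp add: u0 I_def)
    next
      case (Suc n)
      have "{x..<u (Suc n)} \<subseteq> {x..<u n} \<union> {u n..<u (Suc n)}" by auto
      then have "I {x..<u (Suc n)} \<le> I {x..<u n} + I {u n..<u (Suc n)}"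
        by (simp add: I_N) (rule order_trans[OF emeasure_mono emeasure_subadditive]; simp)
      also have "\<dots> \<le> ennreal (4 * (g x * f x) * (1 - (1/2) ^ n)) + ennreal (2 * (g x * f x) * (1/2) ^ n)"
        by (intro add_mono Suc cell)
      also have "\<dots> = ennreal (4 * (g x * f x) * (1 - (1/2) ^ n) + 2 * (g x * f x) * (1/2) ^ n)"
        using X[OF x] by (intro ennreal_plus[symmetric]) (auto simp: power_le_one)
      also have "4 * (g x * f x) * (1 - (1/2) ^ n) + 2 * (g x * f x) * (1/2) ^ n
          = 4 * (g x * f x) * (1 - (1/2) ^ Suc n)"
        by (simp add: algebra_simps)
      finally show ?case .
    qed
    have "I {x..} = emeasure N (\<Union>n. {x..<u n})"
      using u_unbounded by (subst I_N) (auto intro!: arg_cong[where f = "emeasure N"])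
    also have "\<dots> = (SUP n. emeasure N {x..<u n})"
      using u_mono by (intro SUP_emeasure_incseq[symmetric])
        (auto simp: incseq_def intro: order_less_le_trans)
    also have "\<dots> \<le> ennreal (4 * (g x * f x))"
    proof (rule SUP_least)
      fix n
      have "ennreal (4 * (g x * f x) * (1 - (1/2) ^ n)) \<le> ennreal (4 * (g x * f x))"
        using X[OF x] by (intro ennreal_leI mult_left_le) auto
      with partial[of n] show "emeasure N {x..<u n} \<le> ennreal (4 * (g x * f x))"
        by (simp add: I_N)
    qed
    finally have "I {x..} \<le> ennreal (4 * (g x * f x))" .
    with lower show "ennreal (g x * f x / 4) \<le> (\<integral>\<^sup>+y. ennreal (f y) * indicator {x..} y \<partial>lborel) \<and>
      (\<integral>\<^sup>+y. ennreal (f y) * indicator {x..} y \<partial>lborel) \<le> ennreal (4 * (g x * f x))"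
      unfolding I_def by blast
  qed
qed

section \<open>The Williamson transform and Kendall powers\<close>

lemma interval_measure_cdf_eq:
  assumes "real_distribution \<mu>"
  shows "interval_measure (cdf \<mu>) = \<mu>"
proof -
  interpret real_distribution \<mu> by fact
  show ?thesis
    by (intro cdf_unique real_distribution_interval_measure cdf_interval_measure cdf_nondecreasing
        cdf_is_right_cont cdf_lim_at_bot cdf_lim_at_top_prob assms)
qed

lemma nonneg_distribution_functionE:
  assumes "nonneg_distribution_function F"
  obtains \<mu> where "real_distribution \<mu>" "F = cdf \<mu>" "interval_measure F = \<mu>" "measure \<mu> {..<0} = 0"
proof -
  obtain \<mu> where \<mu>: "real_distribution \<mu>" "F = cdf \<mu>" and lim: "(F \<longlongrightarrow> 0) (at_left 0)"
    using assms unfolding nonneg_distribution_function_def by blast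
  interpret real_distribution \<mu> by fact
  have "measure \<mu> {..<0} = 0"
    using tendsto_unique[OF _ cdf_at_left[of 0] lim[unfolded \<mu>(2)]] by simp
  then show ?thesis
    using that \<mu> interval_measure_cdf_eq by metis
qed

lemma nonneg_distribution_function_basics:
  assumes "nonneg_distribution_function F"
  shows nonneg_df_mono: "x \<le> y \<Longrightarrow> F x \<le> F y"
    and nonneg_df_le_1: "F x \<le> 1"
    and nonneg_df_neg: "x < 0 \<Longrightarrow> F x = 0"
    and nonneg_df_right_cont: "continuous (at_right x) F"
    and nonneg_df_at_top: "(F \<longlongrightarrow> 1) at_top"
proof -
  obtain \<mu> where \<mu>: "real_distribution \<mu>" "F = cdf \<mu>" "measure \<mu> {..<0} = 0"
    using nonneg_distribution_functionE[OF assms] .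
  interpret real_distribution \<mu> by fact
  show "x \<le> y \<Longrightarrow> F x \<le> F y" "F x \<le> 1"
      "continuous (at_right x) F" "(F \<longlongrightarrow> 1) at_top"
    unfolding \<mu>(2)
    by (auto intro: cdf_nondecreasing cdf_bounded_prob cdf_is_right_cont cdf_lim_at_top_prob)
  show "F x = 0" if "x < 0"
  proof -
    have "measure \<mu> {..x} \<le> measure \<mu> {..<0}"
      using that by (intro finite_measure_mono) auto
    then show ?thesis
      using \<mu>(3) measure_nonneg[of \<mu> "{..x}"] unfolding \<mu>(2) cdf_def by linarith
  qed
qed

lemma williamson_scaled_eq:
  assumes "real_distribution \<mu>" "x > 0"
  shows "x powr \<alpha> * williamson_transform \<alpha> (cdf \<mu>) x
    = (\<integral>t. indicator {0..x} t * (x powr \<alpha> - t powr \<alpha>) \<partial>\<mu>)"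
  unfolding williamson_transform_def interval_measure_cdf_eq[OF assms(1)] set_lebesgue_integral_def
    integral_mult_right_zero[symmetric]
  using assms(2)
  by (intro Bochner_Integration.integral_cong)
    (auto simp: indicator_def powr_divide right_diff_distrib)

text \<open>The product \<open>x powr \<alpha> * williamson_transform \<alpha> F x\<close> is the mean of the positive part of
  \<open>x powr \<alpha> - t powr \<alpha>\<close>. Between \<open>x\<close> and \<open>y\<close> the integrand grows by the full increment of the power
  for \<open>t \<le> x\<close>, by at most that for \<open>x < t \<le> y\<close>, and not at all beyond. Thus \<open>F\<close> is squeezed by difference
  quotients of its transform, which gives both its inversion and its uniqueness.\<close>

lemma williamson_increment:
  assumes F: "nonneg_distribution_function F" and "\<alpha> > 0" "0 < x" "x \<le> y"
  shows "(y powr \<alpha> - x powr \<alpha>) * F x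
      \<le> y powr \<alpha> * williamson_transform \<alpha> F y - x powr \<alpha> * williamson_transform \<alpha> F x"
    and "y powr \<alpha> * williamson_transform \<alpha> F y - x powr \<alpha> * williamson_transform \<alpha> F x
      \<le> (y powr \<alpha> - x powr \<alpha>) * F y"
proof -
  obtain \<mu> where \<mu>: "real_distribution \<mu>" "F = cdf \<mu>" "measure \<mu> {..<0} = 0"
    using nonneg_distribution_functionE[OF F] .
  interpret real_distribution \<mu> by fact
  define k where "k x t = indicator {0..x} t * (x powr \<alpha> - t powr \<alpha>)" for x t :: real
  have k_int: "integrable \<mu> (k z)" if "z > 0" for z
  proof -
    have "\<bar>z powr \<alpha> - t powr \<alpha>\<bar> \<le> z powr \<alpha>" if "0 \<le> t" "t \<le> z" for t
      using that \<open>\<alpha> > 0\<close> powr_mono2[of \<alpha> t z] by simp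
    then show ?thesis
      unfolding k_def
      by (intro integrable_const_bound[where B = "z powr \<alpha>"]) (auto simp: indicator_def)
  qed
  have cdf_eq: "measure \<mu> {0..z} = F z" for z
  proof -
    have "measure \<mu> {..z} \<le> measure \<mu> ({..<0} \<union> {0..z})"
      by (intro finite_measure_mono) auto
    also have "\<dots> \<le> measure \<mu> {..<0} + measure \<mu> {0..z}"
      by (intro measure_Un_le) auto
    finally have "F z \<le> measure \<mu> {0..z}"
      using \<mu>(3) unfolding \<mu>(2) cdf_def by simp
    moreover have "measure \<mu> {0..z} \<le> F z"
      unfolding \<mu>(2) cdf_def by (intro finite_measure_mono) auto
    ultimately show ?thesis by simp
  qed
  have const: "(\<integral>t. (y powr \<alpha> - x powr \<alpha>) * indicator {0..z} t \<partial>\<mu>) = (y powr \<alpha> - x powr \<alpha>) * F z" for z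
    using cdf_eq by simp
  have diff: "y powr \<alpha> * williamson_transform \<alpha> F y - x powr \<alpha> * williamson_transform \<alpha> F x
      = (\<integral>t. k y t - k x t \<partial>\<mu>)"
    using assms williamson_scaled_eq[OF \<mu>(1)] k_int
    by (simp add: k_def[abs_def] \<mu>(2))
  have "x powr \<alpha> \<le> y powr \<alpha>"
    using assms by (intro powr_mono2) auto
  have ind_int: "integrable \<mu> (\<lambda>t. (y powr \<alpha> - x powr \<alpha>) * indicator {0..z} t)" for z
    by (intro integrable_mult_right integrable_real_indicator) (auto simp: emeasure_eq_measure)
  show "(y powr \<alpha> - x powr \<alpha>) * F x
      \<le> y powr \<alpha> * williamson_transform \<alpha> F y - x powr \<alpha> * williamson_transform \<alpha> F x"
    unfolding diff const[symmetric]
  proof (intro integral_mono ind_int Bochner_Integration.integrable_diff k_int)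
    show "(y powr \<alpha> - x powr \<alpha>) * indicator {0..x} t \<le> k y t - k x t" for t
      using assms by (auto simp: k_def indicator_def intro!: powr_mono2)
  qed (use assms in auto)
  show "y powr \<alpha> * williamson_transform \<alpha> F y - x powr \<alpha> * williamson_transform \<alpha> F x
      \<le> (y powr \<alpha> - x powr \<alpha>) * F y"
    unfolding diff const[symmetric]
  proof (intro integral_mono ind_int Bochner_Integration.integrable_diff k_int)
    show "k y t - k x t \<le> (y powr \<alpha> - x powr \<alpha>) * indicator {0..y} t" for t
      using assms \<open>x powr \<alpha> \<le> y powr \<alpha>\<close> powr_mono2[of \<alpha> x t]
      by (auto simp: k_def indicator_def)
  qed (use assms in auto)
qed

lemma williamson_bounds:
  assumes F: "nonneg_distribution_function F" and "\<alpha> > 0" "0 < x"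
  shows "0 \<le> williamson_transform \<alpha> F x" "williamson_transform \<alpha> F x \<le> F x"
proof -
  obtain \<mu> where \<mu>: "real_distribution \<mu>" "F = cdf \<mu>" "interval_measure F = \<mu>" "measure \<mu> {..<0} = 0"
    using nonneg_distribution_functionE[OF F] .
  interpret real_distribution \<mu> by fact
  have W: "williamson_transform \<alpha> F x = (\<integral>t. indicator {0..x} t * (1 - (t / x) powr \<alpha>) \<partial>\<mu>)"
    unfolding williamson_transform_def \<mu>(3) set_lebesgue_integral_def by simp
  have le1: "(t / x) powr \<alpha> \<le> 1" if "0 \<le> t" "t \<le> x" for t
    using that assms powr_mono2[of \<alpha> "t / x" 1] by simp
  have int: "integrable \<mu> (\<lambda>t. indicator {0..x} t * (1 - (t / x) powr \<alpha>))"
    by (intro integrable_const_bound[where B = 1]) (auto simp: indicator_def le1)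
  show "0 \<le> williamson_transform \<alpha> F x"
    unfolding W by (intro integral_nonneg_AE AE_I2) (auto simp: indicator_def le1)
  have "williamson_transform \<alpha> F x \<le> (\<integral>t. indicator {..x} t \<partial>\<mu>)"
    unfolding W
    by (intro integral_mono int integrable_real_indicator)
      (auto simp: indicator_def le1 emeasure_eq_measure)
  then show "williamson_transform \<alpha> F x \<le> F x"
    unfolding \<mu>(2) cdf_def by simp
qed

lemma williamson_scaled_deriv:
  assumes F: "nonneg_distribution_function F" and "\<alpha> > 0" "0 < x" and cont: "isCont F x"
  shows "((\<lambda>x. x powr \<alpha> * williamson_transform \<alpha> F x) has_real_derivative \<alpha> * x powr (\<alpha> - 1) * F x) (at x)"
proof -
  define K where "K x = x powr \<alpha> * williamson_transform \<alpha> F x" for x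
  define S where "S y = (y powr \<alpha> - x powr \<alpha>) / (y - x)" for y
  have S: "(S \<longlongrightarrow> \<alpha> * x powr (\<alpha> - 1)) (at x)"
    using has_real_derivative_powr[OF \<open>0 < x\<close>, of \<alpha>]
    unfolding has_field_derivative_iff S_def by simp
  have Fx: "(F \<longlongrightarrow> F x) (at x)"
    using cont by (simp add: isCont_def)
  have "((\<lambda>y. (K y - K x) / (y - x) - S y * F x) \<longlongrightarrow> 0) (at x)"
  proof (rule Lim_null_comparison)
    show "((\<lambda>y. \<bar>S y\<bar> * \<bar>F y - F x\<bar>) \<longlongrightarrow> 0) (at x)"
      by (rule tendsto_eq_intros S Fx refl | simp)+
    have "\<forall>\<^sub>F y in at x. 0 < y"
      using order_tendstoD(1)[OF tendsto_ident_at \<open>0 < x\<close>] .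
    moreover have "\<forall>\<^sub>F y in at x. y \<noteq> x"
      by (simp add: eventually_at_filter)
    ultimately show "\<forall>\<^sub>F y in at x. norm ((K y - K x) / (y - x) - S y * F x) \<le> \<bar>S y\<bar> * \<bar>F y - F x\<bar>"
    proof eventually_elim
      case (elim y)
      have "\<bar>K y - K x - (y powr \<alpha> - x powr \<alpha>) * F x\<bar> \<le> \<bar>(y powr \<alpha> - x powr \<alpha>) * (F y - F x)\<bar>"
      proof (cases "x \<le> y")
        case True
        then show ?thesis
          using williamson_increment[OF F \<open>\<alpha> > 0\<close> \<open>0 < x\<close> True]
          unfolding K_def by (simp add: right_diff_distrib)
      next
        case False
        then show ?thesis
          using williamson_increment[OF F \<open>\<alpha> > 0\<close> \<open>0 < y\<close>, of x]
          unfolding K_def by (simp add: algebra_simps)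
      qed
      then have "\<bar>(K y - K x - (y powr \<alpha> - x powr \<alpha>) * F x) / (y - x)\<bar>
          \<le> \<bar>(y powr \<alpha> - x powr \<alpha>) * (F y - F x) / (y - x)\<bar>"
        by (simp add: abs_divide divide_right_mono)
      moreover have "(K y - K x - (y powr \<alpha> - x powr \<alpha>) * F x) / (y - x) = (K y - K x) / (y - x) - S y * F x"
        unfolding S_def by (subst diff_divide_distrib) simp
      moreover have "(y powr \<alpha> - x powr \<alpha>) * (F y - F x) / (y - x) = S y * (F y - F x)"
        by (simp add: S_def)
      ultimately show ?case
        by (simp add: abs_mult)
    qed
  qed
  from tendsto_add[OF this tendsto_mult[OF S tendsto_const[of "F x"]]]
  show ?thesis
    unfolding has_field_derivative_iff K_def by simp
qed

lemma williamson_inject: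
  assumes F1: "nonneg_distribution_function F1" and F2: "nonneg_distribution_function F2"
    and "\<alpha> > 0"
    and eq: "\<And>x. x > 0 \<Longrightarrow> williamson_transform \<alpha> F1 x = williamson_transform \<alpha> F2 x"
  shows "F1 = F2"
proof -
  have le: "H1 x \<le> H2 x"
    if H: "nonneg_distribution_function H1" "nonneg_distribution_function H2"
      and eqH: "\<And>x. x > 0 \<Longrightarrow> williamson_transform \<alpha> H1 x = williamson_transform \<alpha> H2 x"
      and "x > 0" for H1 H2 x
  proof (rule tendsto_lowerbound)
    show "(H2 \<longlongrightarrow> H2 x) (at_right x)"
      using nonneg_df_right_cont[OF H(2), of x] by (simp add: continuous_within)
    show "\<forall>\<^sub>F y in at_right x. H1 x \<le> H2 y"
      using eventually_at_right_less[of x]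
    proof eventually_elim
      case (elim y)
      have "(y powr \<alpha> - x powr \<alpha>) * H1 x \<le> (y powr \<alpha> - x powr \<alpha>) * H2 y"
        using williamson_increment(1)[OF H(1) \<open>\<alpha> > 0\<close> \<open>x > 0\<close>, of y]
          williamson_increment(2)[OF H(2) \<open>\<alpha> > 0\<close> \<open>x > 0\<close>, of y] eqH[of x] eqH[of y] \<open>x > 0\<close> elim
        by simp
      moreover have "x powr \<alpha> < y powr \<alpha>"
        using \<open>x > 0\<close> elim \<open>\<alpha> > 0\<close> by (intro powr_less_mono2) auto
      ultimately show ?case by simp
    qed
  qed simp
  have pos: "F1 x = F2 x" if "x > 0" for x
    using le[OF F1 F2 eq that] le[OF F2 F1 eq[symmetric] that] by simp
  have "F1 x = F2 x" for x
  proof (cases x "0 :: real" rule: linorder_cases)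
    case less
    then show ?thesis
      using nonneg_df_neg[OF F1] nonneg_df_neg[OF F2] by simp
  next
    case equal
    have "(F1 \<longlongrightarrow> F1 0) (at_right 0)" "(F2 \<longlongrightarrow> F2 0) (at_right 0)"
      using nonneg_df_right_cont[OF F1, of 0] nonneg_df_right_cont[OF F2, of 0]
      by (simp_all add: continuous_within)
    moreover have "\<forall>\<^sub>F y in at_right 0. F1 y = F2 y"
      using eventually_at_right_less[of "0::real"] by eventually_elim (rule pos)
    ultimately have "(F2 \<longlongrightarrow> F1 0) (at_right 0)" "(F2 \<longlongrightarrow> F2 0) (at_right 0)"
      by (simp_all add: tendsto_cong)
    then have "F1 0 = F2 0"
      by (rule tendsto_unique[OF trivial_limit_at_right_real])
    then show ?thesis using equal by simp
  qed (rule pos)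
  then show ?thesis ..
qed

text \<open>A primitive of the right density that vanishes at 0 is the scaled transform; in this way the
  transform of a given distribution function is found without computing an integral.\<close>

lemma williamson_eqI:
  assumes P: "nonneg_distribution_function P" and "\<alpha> > 0"
    and cont: "\<And>x. x > 0 \<Longrightarrow> isCont P x"
    and L: "\<And>x. x > 0 \<Longrightarrow> (L has_real_derivative \<alpha> * x powr (\<alpha> - 1) * P x) (at x)"
    and L0: "(L \<longlongrightarrow> 0) (at_right 0)"
    and "x > 0"
  shows "x powr \<alpha> * williamson_transform \<alpha> P x = L x"
proof -
  define D where "D x = L x - x powr \<alpha> * williamson_transform \<alpha> P x" for x
  have D': "(D has_real_derivative 0) (at x)" if "x > 0" for x
    using DERIV_diff[OF L[OF that] williamson_scaled_deriv[OF P \<open>\<alpha> > 0\<close> that cont[OF that]]]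
    unfolding D_def by simp
  have D_const: "D y = D x" if "y > 0" for y
  proof (rule DERIV_isconst3[where f = D and a = 0 and b = "x + y + 1"])
    show "(D has_real_derivative 0) (at z)" if "z \<in> {0<..<x + y + 1}" for z
      using D' that by simp
  qed (use that \<open>x > 0\<close> in auto)
  have "((\<lambda>y. y powr \<alpha> * williamson_transform \<alpha> P y) \<longlongrightarrow> 0) (at_right 0)"
  proof (rule Lim_null_comparison)
    show "\<forall>\<^sub>F y in at_right 0. norm (y powr \<alpha> * williamson_transform \<alpha> P y) \<le> y powr \<alpha>"
      using eventually_at_right_less[of "0::real"]
    proof eventually_elim
      case (elim y)
      then have "0 \<le> williamson_transform \<alpha> P y" "williamson_transform \<alpha> P y \<le> 1"
        using williamson_bounds[OF P \<open>\<alpha> > 0\<close> elim] nonneg_df_le_1[OF P, of y] by auto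
      then show ?case
        by (simp add: abs_mult mult_left_le)
    qed
    show "((\<lambda>y. y powr \<alpha>) \<longlongrightarrow> 0) (at_right 0)"
      using \<open>\<alpha> > 0\<close> by (auto intro!: tendsto_eq_intros simp: eventually_at_right_less eventually_at_filter)
  qed
  from tendsto_diff[OF L0 this] have "(D \<longlongrightarrow> 0) (at_right 0)"
    unfolding D_def by simp
  moreover have "\<forall>\<^sub>F y in at_right 0. D y = D x"
    using eventually_at_right_less[of "0::real"] by eventually_elim (rule D_const)
  ultimately have "((\<lambda>_. D x) \<longlongrightarrow> 0) (at_right (0::real))"
    by (simp add: tendsto_cong)
  then have "D x = 0"
    by (simp add: tendsto_const_iff)
  then show ?thesis unfolding D_def by simp
qed

locale continuous_kendall =
  fixes \<alpha> :: real and F :: "real \<Rightarrow> real"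
  assumes \<alpha>_pos: "\<alpha> > 0"
    and F_df: "nonneg_distribution_function F"
    and F_cont: "\<And>x. isCont F x"
begin

abbreviation G :: "real \<Rightarrow> real" where "G \<equiv> williamson_transform \<alpha> F"

lemma F_nonpos: "x \<le> 0 \<Longrightarrow> F x = 0"
proof -
  have "F 0 = 0"
    using F_cont[of 0] F_df tendsto_unique[of "at_left (0::real)" F "F 0" 0]
    unfolding nonneg_distribution_function_def isCont_def by (auto simp: filterlim_at_split)
  then show "x \<le> 0 \<Longrightarrow> F x = 0"
    using nonneg_df_neg[OF F_df, of x] by (cases "x = 0") auto
qed

lemma G_nonpos: "x \<le> 0 \<Longrightarrow> G x = 0"
proof -
  assume "x \<le> 0"
  obtain \<mu> where \<mu>: "real_distribution \<mu>" "F = cdf \<mu>" "interval_measure F = \<mu>"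
    using nonneg_distribution_functionE[OF F_df] .
  interpret real_distribution \<mu> by fact
  have "measure \<mu> {0} = 0"
    using F_cont[of 0] isCont_cdf unfolding \<mu>(2) by simp
  then have "AE t in \<mu>. t \<noteq> 0"
    by (intro AE_I[of _ _ "{0}"]) (auto simp: emeasure_eq_measure)
  then have "AE t in \<mu>. indicator {0..x} t *\<^sub>R (1 - (t / x) powr \<alpha>) = 0"
    by eventually_elim (use \<open>x \<le> 0\<close> in \<open>auto simp: indicator_def\<close>)
  then show "G x = 0"
    unfolding williamson_transform_def \<mu>(3) set_lebesgue_integral_def by (rule integral_eq_zero_AE)
qed

lemma G_nonneg: "0 \<le> G x" and G_le_F: "G x \<le> F x"
  using williamson_bounds[OF F_df \<alpha>_pos, of x] G_nonpos[of x] F_nonpos[of x] by (cases "x > 0"; simp)+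

lemma F_le_1: "F x \<le> 1"
  by (rule nonneg_df_le_1[OF F_df])

lemma F_mono: "x \<le> y \<Longrightarrow> F x \<le> F y"
  by (rule nonneg_df_mono[OF F_df])

lemma G_deriv:
  assumes "x > 0"
  shows "(G has_real_derivative \<alpha> * (F x - G x) / x) (at x)"
proof -
  define K where "K x = x powr \<alpha> * G x" for x
  have K': "(K has_real_derivative \<alpha> * x powr (\<alpha> - 1) * F x) (at x)"
    unfolding K_def by (rule williamson_scaled_deriv[OF F_df \<alpha>_pos assms F_cont])
  have "((\<lambda>x. x powr (- \<alpha>) * K x) has_real_derivative
      x powr (- \<alpha>) * (\<alpha> * x powr (\<alpha> - 1) * F x) + (- \<alpha> * x powr (- \<alpha> - 1)) * K x) (at x)"
    by (rule DERIV_cong[OF DERIV_mult[OF has_real_derivative_powr[OF assms] K']]) simp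
  moreover have "x powr (- \<alpha>) * (\<alpha> * x powr (\<alpha> - 1) * F x) + (- \<alpha> * x powr (- \<alpha> - 1)) * K x
      = \<alpha> * (F x - G x) / x"
    using assms unfolding K_def
    by (simp add: powr_diff powr_minus field_simps)
  ultimately have *: "((\<lambda>x. x powr (- \<alpha>) * K x) has_real_derivative \<alpha> * (F x - G x) / x) (at x)"
    by simp
  show ?thesis
  proof (rule has_field_derivative_transform_within_open[OF *])
    show "x powr (- \<alpha>) * K x = G x" if "x \<in> {0<..}" for x
      using that unfolding K_def by (simp add: powr_minus)
  qed (use assms in auto)
qed

lemma G_cont: "isCont G x"
proof (cases x "0 :: real" rule: linorder_cases)
  case less
  have "isCont (\<lambda>_::real. 0::real) x \<longleftrightarrow> isCont G x"
    by (rule isCont_cong) (use less G_nonpos in \<open>auto simp: eventually_nhds_metric intro!: exI[of _ "- x"] simp: dist_real_def\<close>)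
  then show ?thesis by simp
next
  case equal
  have "((\<lambda>y. G y) \<longlongrightarrow> 0) (at 0)"
  proof (rule Lim_null_comparison[OF always_eventually])
    show "\<forall>y. norm (G y) \<le> F y"
      using G_nonneg G_le_F by simp
    show "(F \<longlongrightarrow> 0) (at 0)"
      using F_cont[of 0] F_nonpos[of 0] unfolding isCont_def by simp
  qed
  then show ?thesis
    using equal G_nonpos[of 0] unfolding isCont_def by simp
next
  case greater
  then show ?thesis using G_deriv DERIV_isCont by blast
qed

lemma G_mono: "x \<le> y \<Longrightarrow> G x \<le> G y"
proof (cases "x > 0")
  case True
  assume "x \<le> y"
  have "(y powr \<alpha> - x powr \<alpha>) * G x \<le> (y powr \<alpha> - x powr \<alpha>) * F x"
    using True \<open>x \<le> y\<close> \<alpha>_pos G_le_F[of x] by (intro mult_left_mono) (auto intro: powr_mono2)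
  then have "y powr \<alpha> * G x \<le> y powr \<alpha> * G y"
    using williamson_increment(1)[OF F_df \<alpha>_pos True \<open>x \<le> y\<close>] by (simp add: algebra_simps)
  then show ?thesis
    using True \<open>x \<le> y\<close> by simp
next
  case False
  then show ?thesis using G_nonpos[of x] G_nonneg[of y] by simp
qed

text \<open>Compare with the point \<open>sqrt y\<close>: both \<open>F (sqrt y)\<close> and the share \<open>1 - y powr (- \<alpha> / 2)\<close> of
  \<open>y powr \<alpha>\<close> gained between \<open>sqrt y\<close> and \<open>y\<close> tend to 1.\<close>

lemma G_at_top: "(G \<longlongrightarrow> 1) at_top"
proof (rule tendsto_sandwich)
  show "\<forall>\<^sub>F y in at_top. (1 - y powr (- \<alpha> / 2)) * F (sqrt y) \<le> G y"
    using eventually_gt_at_top[of 1]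
  proof eventually_elim
    case (elim y)
    have "sqrt y \<le> y"
      using elim by (simp add: real_le_lsqrt power2_eq_square real_sqrt_le_iff sqrt_le_D)
    have pow: "y powr \<alpha> = y powr (\<alpha> / 2) * y powr (\<alpha> / 2)" "sqrt y powr \<alpha> = y powr (\<alpha> / 2)"
      using elim by (simp_all add: powr_add[symmetric] powr_half_sqrt[symmetric] powr_powr)
    have "(y powr \<alpha> - sqrt y powr \<alpha>) * F (sqrt y) \<le> y powr \<alpha> * G y - sqrt y powr \<alpha> * G (sqrt y)"
      using williamson_increment(1)[OF F_df \<alpha>_pos _ \<open>sqrt y \<le> y\<close>] elim by simp
    also have "\<dots> \<le> y powr \<alpha> * G y"
      using G_nonneg by simp
    finally have "y powr \<alpha> * ((1 - y powr (- \<alpha> / 2)) * F (sqrt y)) \<le> y powr \<alpha> * G y"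
      using elim unfolding pow by (simp add: algebra_simps powr_minus)
    then show ?case using elim by simp
  qed
  show "\<forall>\<^sub>F y in at_top. G y \<le> 1"
    using G_le_F F_le_1 order_trans by (intro always_eventually) blast
  have "((\<lambda>y. y powr (- \<alpha> / 2)) \<longlongrightarrow> 0) at_top"
    using \<alpha>_pos by (intro tendsto_neg_powr filterlim_ident) auto
  then have "((\<lambda>y. (1 - y powr (- \<alpha> / 2)) * F (sqrt y)) \<longlongrightarrow> (1 - 0) * 1) at_top"
    by (intro tendsto_intros filterlim_compose[OF nonneg_df_at_top[OF F_df] sqrt_at_top])
  then show "((\<lambda>y. (1 - y powr (- \<alpha> / 2)) * F (sqrt y)) \<longlongrightarrow> 1) at_top"
    by simp
qed auto

text \<open>The inversion formula \<open>H + (x / \<alpha>) * H'\<close> applied to \<open>H = G ^ Suc n\<close>, with \<open>(x / \<alpha>) * G' = F - G\<close>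
  inserted. It is the distribution function of the Kendall power of exponent \<open>Suc n\<close>.\<close>

definition conv_power :: "nat \<Rightarrow> real \<Rightarrow> real" where
  "conv_power n x = real (Suc n) * G x ^ n * F x - real n * G x ^ Suc n"

text \<open>As a polynomial in \<open>G\<close> and \<open>F\<close> the expression is increasing in \<open>F\<close>, and increasing in \<open>G\<close> as long as
  \<open>G \<le> F\<close>; so \<open>F\<close> is moved first.\<close>

lemma conv_power_mono:
  assumes "x \<le> y"
  shows "conv_power n x \<le> conv_power n y"
proof -
  have "real (Suc n) * G x ^ n * F x - real n * G x ^ Suc n
      \<le> real (Suc n) * G x ^ n * F y - real n * G x ^ Suc n"
    using G_nonneg F_mono[OF assms] by (intro diff_right_mono mult_left_mono) auto
  also have "\<dots> \<le> real (Suc n) * G y ^ n * F y - real n * G y ^ Suc n"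
  proof (rule DERIV_nonneg_imp_nondecreasing[OF G_mono[OF assms]])
    fix u assume u: "G x \<le> u" "u \<le> G y"
    let ?d = "real (Suc n) * (real n * u ^ (n - Suc 0)) * F y - real n * (real (Suc n) * u ^ n)"
    have "((\<lambda>u. real (Suc n) * u ^ n * F y - real n * u ^ Suc n) has_real_derivative ?d) (at u)"
      using DERIV_pow[of "Suc n" u] DERIV_pow[of n u]
      by (intro DERIV_diff DERIV_cmult DERIV_cmult_right) simp_all
    moreover have "?d = real (Suc n) * real n * u ^ (n - 1) * (F y - u)"
      by (cases n) (simp_all add: algebra_simps)
    moreover have "0 \<le> real (Suc n) * real n * u ^ (n - 1) * (F y - u)"
      using u G_nonneg[of x] G_le_F[of y] by (intro mult_nonneg_nonneg) auto
    ultimately show "\<exists>d. ((\<lambda>u. real (Suc n) * u ^ n * F y - real n * u ^ Suc n) has_real_derivative d) (at u) \<and> 0 \<le> d"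
      by (intro exI[of _ ?d]) simp
  qed
  finally show ?thesis unfolding conv_power_def .
qed

lemma conv_power_cont: "isCont (conv_power n) x"
  unfolding conv_power_def by (intro continuous_intros G_cont F_cont)

lemma conv_power_nonpos: "x \<le> 0 \<Longrightarrow> conv_power n x = 0"
  by (simp add: conv_power_def G_nonpos F_nonpos)

lemma conv_power_df: "nonneg_distribution_function (conv_power n)"
proof -
  have right: "continuous (at_right a) (conv_power n)" for a
    using conv_power_cont continuous_at_imp_continuous_at_within by blast
  have "\<forall>\<^sub>F x in at_bot. conv_power n x = 0"
    using eventually_le_at_bot[of 0] by eventually_elim (rule conv_power_nonpos)
  then have bot: "(conv_power n \<longlongrightarrow> 0) at_bot"
    by (simp add: tendsto_cong)
  have "((\<lambda>x. real (Suc n) * G x ^ n * F x - real n * G x ^ Suc n) \<longlongrightarrow>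
      real (Suc n) * 1 ^ n * 1 - real n * 1 ^ Suc n) at_top"
    by (intro tendsto_intros G_at_top nonneg_df_at_top[OF F_df])
  then have top: "(conv_power n \<longlongrightarrow> 1) at_top"
    unfolding conv_power_def by simp
  have "(conv_power n \<longlongrightarrow> 0) (at_left 0)"
    using conv_power_cont[where n = n and x = 0] conv_power_nonpos[where n = n and x = 0] unfolding isCont_def by (simp add: filterlim_at_split)
  then show ?thesis
    unfolding nonneg_distribution_function_def
    using real_distribution_interval_measure[OF conv_power_mono right bot top]
      cdf_interval_measure[OF conv_power_mono right bot] by metis
qed

lemma williamson_conv_power:
  assumes "x > 0"
  shows "williamson_transform \<alpha> (conv_power n) x = G x ^ Suc n"
proof -
  have "x powr \<alpha> * williamson_transform \<alpha> (conv_power n) x = x powr \<alpha> * G x ^ Suc n"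
  proof (rule williamson_eqI[OF conv_power_df \<alpha>_pos conv_power_cont _ _ assms])
    fix x :: real assume x: "x > 0"
    have "((\<lambda>x. x powr \<alpha> * G x ^ Suc n) has_real_derivative
        x powr \<alpha> * (real (Suc n) * G x ^ n * (\<alpha> * (F x - G x) / x)) + \<alpha> * x powr (\<alpha> - 1) * G x ^ Suc n) (at x)"
      by (rule DERIV_cong[OF DERIV_mult[OF has_real_derivative_powr[OF x] DERIV_power[OF G_deriv[OF x]]]]) simp
    moreover have "x powr \<alpha> * (real (Suc n) * G x ^ n * (\<alpha> * (F x - G x) / x)) + \<alpha> * x powr (\<alpha> - 1) * G x ^ Suc n
        = \<alpha> * x powr (\<alpha> - 1) * conv_power n x"
      using x by (simp add: conv_power_def powr_diff field_simps)
    ultimately show "((\<lambda>x. x powr \<alpha> * G x ^ Suc n) has_real_derivative \<alpha> * x powr (\<alpha> - 1) * conv_power n x) (at x)"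
      by simp
  next
    have "(G \<longlongrightarrow> 0) (at_right 0)"
      using G_cont[of 0] G_nonpos[of 0] unfolding isCont_def by (simp add: filterlim_at_split)
    then have "((\<lambda>x. x powr \<alpha> * G x ^ Suc n) \<longlongrightarrow> 0 powr \<alpha> * 0 ^ Suc n) (at_right 0)"
      using \<alpha>_pos by (intro tendsto_intros tendsto_powr') (auto simp: eventually_at_right_less eventually_at_filter)
    then show "((\<lambda>x. x powr \<alpha> * G x ^ Suc n) \<longlongrightarrow> 0) (at_right 0)"
      by simp
  qed
  then show ?thesis using assms by simp
qed

lemma williamson_return:
  assumes "x > 0"
  shows "williamson_transform \<alpha> (cdf (return borel 0)) x = 1"
proof -
  have "real_distribution (return borel (0::real))"
    by (intro real_distribution.intro prob_space_return real_distribution_axioms.intro) auto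
  then show ?thesis
    using assms \<alpha>_pos unfolding williamson_transform_def set_lebesgue_integral_def
    by (simp add: interval_measure_cdf_eq integral_return)
qed

text \<open>The transform of one power and the closed form of the next are proved together: the former is
  what makes the description defining the latter satisfiable, and injectivity makes it unique.\<close>

lemma williamson_kendall_power_and_Suc:
  "(\<forall>x>0. williamson_transform \<alpha> (kendall_power \<alpha> F n) x = G x ^ n) \<and> kendall_power \<alpha> F (Suc n) = conv_power n"
proof (induction n)
  have step: "kendall_power \<alpha> F (Suc n) = conv_power n"
    if "\<forall>x>0. williamson_transform \<alpha> (kendall_power \<alpha> F n) x = G x ^ n" for n
  proof -
    have "kendall_power \<alpha> F (Suc n) = (THE F3. nonneg_distribution_function F3 \<and>
        (\<forall>x>0. williamson_transform \<alpha> F3 x = G x ^ Suc n))"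
      using that by (simp add: kendall_conv_def cong: conj_cong)
    also have "\<dots> = conv_power n"
    proof (rule the_equality)
      show "nonneg_distribution_function (conv_power n) \<and> (\<forall>x>0. williamson_transform \<alpha> (conv_power n) x = G x ^ Suc n)"
        using conv_power_df williamson_conv_power by blast
      show "F3 = conv_power n" if "nonneg_distribution_function F3 \<and> (\<forall>x>0. williamson_transform \<alpha> F3 x = G x ^ Suc n)" for F3
        using that williamson_conv_power by (intro williamson_inject[OF _ conv_power_df \<alpha>_pos]) auto
    qed
    finally show ?thesis .
  qed
  {
    case 0
    show ?case using step[of 0] williamson_return by simp
  next
    case (Suc n)
    then have "\<forall>x>0. williamson_transform \<alpha> (kendall_power \<alpha> F (Suc n)) x = G x ^ Suc n"
      using williamson_conv_power by simp
    then show ?case using step by blast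
  }
qed

lemma kendall_power_Suc: "kendall_power \<alpha> F (Suc n) = conv_power n"
  using williamson_kendall_power_and_Suc by blast

lemma kendall_renewal_eq:
  assumes "x > 0" "G x < 1"
  shows "kendall_renewal \<alpha> F x = (1 - 2 * G x + F x) / (1 - G x)\<^sup>2"
proof -
  have norm: "norm (G x) < 1" using G_nonneg[of x] assms by simp
  note d = geometric_deriv_sums[OF norm] and s = geometric_sums[OF norm]
  have "(\<lambda>n. real (Suc n) * G x ^ n * F x - G x * (real (Suc n) * G x ^ n - G x ^ n))
      sums (1 / (1 - G x)\<^sup>2 * F x - G x * (1 / (1 - G x)\<^sup>2 - 1 / (1 - G x)))"
    by (intro sums_diff sums_mult sums_mult2) (use d s in auto)
  then have "(\<lambda>n. kendall_power \<alpha> F (Suc n) x)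
      sums (1 / (1 - G x)\<^sup>2 * F x - G x * (1 / (1 - G x)\<^sup>2 - 1 / (1 - G x)))"
    unfolding kendall_power_Suc conv_power_def by (simp add: algebra_simps)
  then have "(\<lambda>n. kendall_power \<alpha> F n x)
      sums (1 / (1 - G x)\<^sup>2 * F x - G x * (1 / (1 - G x)\<^sup>2 - 1 / (1 - G x)) + kendall_power \<alpha> F 0 x)"
    by (rule sums_Suc)
  moreover have "kendall_power \<alpha> F 0 x = 1"
    using assms(1) by (simp add: cdf_def measure_return)
  moreover have "1 / (1 - G x)\<^sup>2 * F x - G x * (1 / (1 - G x)\<^sup>2 - 1 / (1 - G x)) + 1
      = (1 - 2 * G x + F x) / (1 - G x)\<^sup>2"
    using assms(2) by (simp add: divide_simps power2_eq_square) (simp add: algebra_simps)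
  ultimately show ?thesis
    unfolding kendall_renewal_def by (simp add: sums_unique[symmetric])
qed

lemma deriv_kendall_renewal:
  assumes "x > 0" "G x < 1" and F': "(F has_real_derivative d) (at x)"
  shows "deriv (kendall_renewal \<alpha> F) x
    = d / (1 - G x)\<^sup>2 + 2 * \<alpha> * (F x - G x)\<^sup>2 / (x * (1 - G x) ^ 3)"
proof (rule DERIV_imp_deriv)
  have alg: "((d - 2 * q) * u\<^sup>2 - (u + e) * (2 * u * (- q))) / (u\<^sup>2 * u\<^sup>2)
      = d / u\<^sup>2 + 2 * q * e / u ^ 3" if "u \<noteq> 0" for q u e :: real
    using that by (simp add: field_simps power2_eq_square power3_eq_cube)
  have ring: "(0 - (0 * g + q * 2) + d) * v - (1 - 2 * g + f) * (real 2 * ((0 - q) * (1 - g) ^ (2 - Suc 0)))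
      = (d - 2 * q) * v - ((1 - g) + (f - g)) * (2 * (1 - g) * (- q))" for q g f v :: real
    by (simp add: algebra_simps)
  let ?q = "\<alpha> * (F x - G x) / x"
  have "((\<lambda>x. (1 - 2 * G x + F x) / (1 - G x)\<^sup>2) has_real_derivative
      ((d - 2 * ?q) * (1 - G x)\<^sup>2 - ((1 - G x) + (F x - G x)) * (2 * (1 - G x) * (- ?q)))
        / ((1 - G x)\<^sup>2 * (1 - G x)\<^sup>2)) (at x)"
    by ((rule derivative_eq_intros G_deriv F' assms(1) refl)+, use assms in simp,
        rule arg_cong2[where f = "(/)"], rule ring, rule refl)
  moreover have "((d - 2 * ?q) * (1 - G x)\<^sup>2 - ((1 - G x) + (F x - G x)) * (2 * (1 - G x) * (- ?q)))
        / ((1 - G x)\<^sup>2 * (1 - G x)\<^sup>2) = d / (1 - G x)\<^sup>2 + 2 * \<alpha> * (F x - G x)\<^sup>2 / (x * (1 - G x) ^ 3)"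
    by (subst alg) (use assms in \<open>simp_all add: power2_eq_square mult.assoc\<close>)
  ultimately have "((\<lambda>x. (1 - 2 * G x + F x) / (1 - G x)\<^sup>2) has_real_derivative
      d / (1 - G x)\<^sup>2 + 2 * \<alpha> * (F x - G x)\<^sup>2 / (x * (1 - G x) ^ 3)) (at x)"
    by (simp only:)
  then show "(kendall_renewal \<alpha> F has_real_derivative
     d / (1 - G x)\<^sup>2 + 2 * \<alpha> * (F x - G x)\<^sup>2 / (x * (1 - G x) ^ 3)) (at x)"
  proof (rule has_field_derivative_transform_within_open)
    show "open ({0<..} \<inter> G -` {..<1})"
      using G_cont by (intro open_Int continuous_open_vimage) (auto simp: continuous_on_eq_continuous_at)
    show "(1 - 2 * G y + F y) / (1 - G y)\<^sup>2 = kendall_renewal \<alpha> F y" if "y \<in> {0<..} \<inter> G -` {..<1}" for y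
      using that by (subst kendall_renewal_eq) auto
  qed (use assms in auto)
qed

end

section \<open>Truncated moments\<close>

locale kendall_moment = continuous_kendall +
  fixes \<mu> :: "real measure"
  assumes \<mu>_distr: "real_distribution \<mu>"
    and F_cdf: "F = cdf \<mu>"
    and \<mu>_pos: "AE t in \<mu>. 0 < t"
    and moment: "integrable \<mu> (\<lambda>t. t powr \<alpha>)"
begin

text \<open>The truncated moment \<open>E (min X x powr \<alpha>)\<close>. It turns the singular denominators \<open>1 - G\<close> of the
  renewal function into a quantity with a positive finite limit.\<close>

definition truncated_moment :: "real \<Rightarrow> real" where "truncated_moment x = x powr \<alpha> * (1 - G x)"

lemma truncated_moment_eq_integral:
  assumes "x > 0"
  shows "truncated_moment x = (\<integral>t. min (x powr \<alpha>) (t powr \<alpha>) \<partial>\<mu>)"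
proof -
  interpret real_distribution \<mu> by (rule \<mu>_distr)
  have int: "integrable \<mu> (\<lambda>t. indicator {0..x} t * (x powr \<alpha> - t powr \<alpha>))"
  proof -
    have "\<bar>x powr \<alpha> - t powr \<alpha>\<bar> \<le> x powr \<alpha>" if "0 \<le> t" "t \<le> x" for t
      using that \<alpha>_pos powr_mono2[of \<alpha> t x] by simp
    then show ?thesis
      by (intro integrable_const_bound[where B = "x powr \<alpha>"]) (auto simp: indicator_def)
  qed
  have "truncated_moment x = (\<integral>t. x powr \<alpha> - indicator {0..x} t * (x powr \<alpha> - t powr \<alpha>) \<partial>\<mu>)"
  proof -
    have "truncated_moment x = x powr \<alpha> - x powr \<alpha> * G x"
      unfolding truncated_moment_def by (simp add: right_diff_distrib)
    also have "x powr \<alpha> * G x = (\<integral>t. indicator {0..x} t * (x powr \<alpha> - t powr \<alpha>) \<partial>\<mu>)"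
      unfolding F_cdf by (rule williamson_scaled_eq[OF \<mu>_distr assms])
    also have "x powr \<alpha> - \<dots> = (\<integral>t. x powr \<alpha> - indicator {0..x} t * (x powr \<alpha> - t powr \<alpha>) \<partial>\<mu>)"
      by (subst Bochner_Integration.integral_diff) (use int prob_space in auto)
    finally show ?thesis .
  qed
  also have "\<dots> = (\<integral>t. min (x powr \<alpha>) (t powr \<alpha>) \<partial>\<mu>)"
  proof (rule integral_cong_AE)
    show "AE t in \<mu>. x powr \<alpha> - indicator {0..x} t * (x powr \<alpha> - t powr \<alpha>) = min (x powr \<alpha>) (t powr \<alpha>)"
      using \<mu>_pos
    proof eventually_elim
      case (elim t)
      then show ?case
        using assms \<alpha>_pos powr_mono2[of \<alpha> t x] powr_mono2[of \<alpha> x t]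
        by (cases "t \<le> x") (auto simp: min_def)
    qed
  qed auto
  finally show ?thesis .
qed

lemma truncated_moment_at_top: "(truncated_moment \<longlongrightarrow> (\<integral>t. t powr \<alpha> \<partial>\<mu>)) at_top"
proof -
  interpret real_distribution \<mu> by (rule \<mu>_distr)
  have "((\<lambda>x. \<integral>t. min (x powr \<alpha>) (t powr \<alpha>) \<partial>\<mu>) \<longlongrightarrow> (\<integral>t. t powr \<alpha> \<partial>\<mu>)) at_top"
  proof (rule integral_dominated_convergence_at_top[OF _ _ moment])
    show "AE t in \<mu>. ((\<lambda>x. min (x powr \<alpha>) (t powr \<alpha>)) \<longlongrightarrow> t powr \<alpha>) at_top"
      using \<mu>_pos
    proof eventually_elim
      case (elim t)
      have "\<forall>\<^sub>F x in at_top. min (x powr \<alpha>) (t powr \<alpha>) = t powr \<alpha>"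
        using eventually_ge_at_top[of t]
        by eventually_elim (use elim \<alpha>_pos in \<open>auto intro!: min.absorb2 powr_mono2\<close>)
      then show ?case by (simp add: tendsto_cong)
    qed
  qed auto
  moreover have "\<forall>\<^sub>F x in at_top. truncated_moment x = (\<integral>t. min (x powr \<alpha>) (t powr \<alpha>) \<partial>\<mu>)"
    using eventually_gt_at_top[of 0] by eventually_elim (rule truncated_moment_eq_integral)
  ultimately show ?thesis
    by (simp add: tendsto_cong)
qed

lemma truncated_moment_le_moment:
  assumes "x > 0"
  shows "truncated_moment x \<le> (\<integral>t. t powr \<alpha> \<partial>\<mu>)"
proof -
  interpret real_distribution \<mu> by (rule \<mu>_distr)
  show ?thesis
    unfolding truncated_moment_eq_integral[OF assms]
    by (intro integral_mono moment Bochner_Integration.integrable_bound[OF moment]) auto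
qed

lemma tail_eq: "1 - F x = measure \<mu> {x<..}"
proof -
  interpret real_distribution \<mu> by (rule \<mu>_distr)
  have "{x<..} = space \<mu> - {..x}" by auto
  then show ?thesis
    using prob_compl[of "{..x}"] unfolding F_cdf cdf_def by simp
qed

lemma moment_tail_lim: "((\<lambda>x. x powr \<alpha> * (1 - F x)) \<longlongrightarrow> 0) at_top"
proof -
  interpret real_distribution \<mu> by (rule \<mu>_distr)
  have "((\<lambda>x. \<integral>t. x powr \<alpha> * indicator {x<..} t \<partial>\<mu>) \<longlongrightarrow> (\<integral>t. 0 \<partial>\<mu>)) at_top"
  proof (rule integral_dominated_convergence_at_top[OF _ _ moment])
    show "\<forall>\<^sub>F x in at_top. AE t in \<mu>. norm (x powr \<alpha> * indicator {x<..} t) \<le> t powr \<alpha>"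
      using eventually_gt_at_top[of 0]
      by eventually_elim (use \<alpha>_pos in \<open>auto simp: indicator_def intro!: powr_mono2\<close>)
    show "AE t in \<mu>. ((\<lambda>x. x powr \<alpha> * indicator {x<..} t) \<longlongrightarrow> 0) at_top"
    proof (rule AE_I2)
      fix t
      have "\<forall>\<^sub>F x in at_top. x powr \<alpha> * indicator {x<..} t = 0"
        using eventually_ge_at_top[of t] by eventually_elim auto
      then show "((\<lambda>x. x powr \<alpha> * indicator {x<..} t) \<longlongrightarrow> 0) at_top"
        by (rule tendsto_eventually)
    qed
  qed auto
  then show ?thesis
    by (simp add: tail_eq)
qed

lemma truncated_moment_deriv:
  assumes "x > 0"
  shows "(truncated_moment has_real_derivative \<alpha> * x powr (\<alpha> - 1) * (1 - F x)) (at x)"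
proof -
  have "((\<lambda>x. x powr \<alpha> - x powr \<alpha> * G x) has_real_derivative
      \<alpha> * x powr (\<alpha> - 1) - \<alpha> * x powr (\<alpha> - 1) * F x) (at x)"
    by (intro DERIV_diff has_real_derivative_powr williamson_scaled_deriv F_df \<alpha>_pos F_cont assms)
  then show ?thesis
    unfolding truncated_moment_def by (simp add: right_diff_distrib)
qed

text \<open>The defect of the truncated moment is the iterated tail of \<open>F\<close>. Two applications of the tail
  estimate for the class Gamma therefore determine its order.\<close>

lemma nn_integral_tail_eq:
  assumes "x > 0"
  shows "(\<integral>\<^sup>+u. ennreal (\<alpha> * u powr (\<alpha> - 1) * (1 - F u)) * indicator {x..} u \<partial>lborel)
    = ennreal ((\<integral>t. t powr \<alpha> \<partial>\<mu>) - truncated_moment x)"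
proof (rule nn_integral_FTC_atLeast)
  have [measurable]: "F \<in> borel_measurable borel"
    using F_cont by (intro borel_measurable_continuous_onI) (simp add: continuous_on_eq_continuous_at)
  show "(\<lambda>u. \<alpha> * u powr (\<alpha> - 1) * (1 - F u)) \<in> borel_measurable borel"
    by measurable
  show "(truncated_moment \<longlongrightarrow> (\<integral>t. t powr \<alpha> \<partial>\<mu>)) at_top"
    by (rule truncated_moment_at_top)
qed (use assms \<alpha>_pos F_le_1 truncated_moment_deriv in \<open>auto intro!: mult_nonneg_nonneg\<close>)

lemma deriv_kendall_renewal_truncated_moment:
  assumes "x > 0" "truncated_moment x > 0" "(F has_real_derivative d) (at x)"
  shows "deriv (kendall_renewal \<alpha> F) x = x powr (2 * \<alpha>) * d / (truncated_moment x)\<^sup>2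
    + 2 * \<alpha> * x powr (\<alpha> - 1) * (truncated_moment x - x powr \<alpha> * (1 - F x))\<^sup>2 / truncated_moment x ^ 3"
proof -
  define p where "p = x powr \<alpha>"
  have p: "p > 0" "x powr (2 * \<alpha>) = p\<^sup>2" "x powr (\<alpha> - 1) = p / x"
    using assms(1) by (simp_all add: p_def powr_diff powr_add[symmetric] power2_eq_square)
  define v where "v = 1 - G x"
  have v: "v > 0" "truncated_moment x = p * v" "F x - G x = v - (1 - F x)"
    using assms(2) p(1) by (simp_all add: truncated_moment_def p_def v_def zero_less_mult_iff)
  have "deriv (kendall_renewal \<alpha> F) x = d / v\<^sup>2 + 2 * \<alpha> * (v - (1 - F x))\<^sup>2 / (x * v ^ 3)"
    using deriv_kendall_renewal[OF assms(1) _ assms(3)] v(1) unfolding v(3)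
    by (simp add: v_def)
  also have "\<dots> = p\<^sup>2 * d / (p * v)\<^sup>2 + 2 * \<alpha> * (p / x) * (p * v - p * (1 - F x))\<^sup>2 / (p * v) ^ 3"
    unfolding right_diff_distrib[symmetric] power_mult_distrib
    using p(1) assms(1) v(1) by (simp add: power2_eq_square power3_eq_cube)
  finally show ?thesis
    unfolding p v(2) p_def[symmetric] .
qed

end

section \<open>Second-order behaviour of the renewal density\<close>

text \<open>Here \<open>p\<close>, \<open>w\<close>, \<open>a\<close>, \<open>e\<close> stand for \<open>x powr \<alpha>\<close>, the truncated moment, the tail \<open>1 - F x\<close> and the
  defect \<open>m - w\<close>. In the sum on the right \<open>- 2 / w\<^sup>2\<close>, the cross term of the expanded square, is the
  only part that does not tend to 0.\<close>

lemma second_order_identity: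
  fixes a e f m p w x :: real
  assumes "a \<noteq> 0" "m \<noteq> 0" "p \<noteq> 0" "w \<noteq> 0" "x \<noteq> 0" and e: "e = m - w"
  shows "1 / (p\<^sup>2 / x * a) * (p\<^sup>2 * f / w\<^sup>2 + 2 * \<alpha> * (p / x) * (w - p * a)\<^sup>2 / w ^ 3
        - 2 * \<alpha> * (p / x) / m - p\<^sup>2 * f / m\<^sup>2)
    = x * f * e / a * ((m + w) / (w\<^sup>2 * m\<^sup>2))
        + 2 * \<alpha> * (e / (p * a) / (w * m) - 2 / w\<^sup>2 + p * a / w ^ 3)"
  unfolding e using assms(1-5)
  by (simp add: field_simps power2_eq_square power3_eq_cube)

theorem theorem13:
  fixes \<alpha> m :: real
    and M :: "'a measure" and X :: "'a \<Rightarrow> real"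
    and F f g R :: "real \<Rightarrow> real"
  assumes alpha: "\<alpha> > 0"
    and M: "prob_space M"
    and X: "X \<in> borel_measurable M"
    and X_pos: "AE \<omega> in M. 0 < X \<omega>"
    and F: "F = cdf (distr M borel X)"
    and moment: "integrable M (\<lambda>\<omega>. X \<omega> powr \<alpha>)"
    and m: "m = (\<integral>\<omega>. X \<omega> powr \<alpha> \<partial>M)"
    and f_nonneg: "\<And>x. 0 \<le> f x"
    and f_density: "distributed M lborel X (\<lambda>x. ennreal (f x))"
    and R: "R = kendall_renewal \<alpha> F"
    and f_Gamma: "f \<in> class_Gamma g"
  shows "((\<lambda>x. 1 / (x powr (2 * \<alpha> - 1) * (1 - F x)) *
             (deriv R x - 2 * \<alpha> * x powr (\<alpha> - 1) / m - x powr (2 * \<alpha>) * f x / m\<^sup>2))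
           \<longlongrightarrow> - (4 * \<alpha> / m\<^sup>2)) (at_top_density_points F f) \<and>
         ((\<lambda>x. m\<^sup>2 / (x powr (2 * \<alpha>) * f x) *
             (deriv R x - 2 * \<alpha> * x powr (\<alpha> - 1) / m))
           \<longlongrightarrow> 1) (at_top_density_points F f)"
proof -
  define \<mu> where "\<mu> = distr M borel X"
  interpret M: prob_space M by (rule M)
  have \<mu>_distr: "real_distribution \<mu>"
    unfolding \<mu>_def using X by (rule M.real_distribution_distr)
  interpret \<mu>: real_distribution \<mu> by (rule \<mu>_distr)
  have F_cdf: "F = cdf \<mu>" unfolding F \<mu>_def ..
  have \<mu>_pos: "AE t in \<mu>. 0 < t"
    unfolding \<mu>_def using X X_pos by (subst AE_distr_iff) auto
  have f_borel [measurable]: "f \<in> borel_measurable borel"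
    using f_Gamma unfolding class_Gamma_def by simp
  have \<mu>_density: "\<mu> = density lborel (\<lambda>x. ennreal (f x))"
  proof -
    have "distr M lborel X = \<mu>"
      unfolding \<mu>_def by (intro distr_cong) auto
    then show ?thesis
      using distributed_distr_eq_density[OF f_density] by simp
  qed
  have no_atom: "measure \<mu> {x} = 0" for x
  proof -
    have "emeasure \<mu> {x} = (\<integral>\<^sup>+y. ennreal (f y) * indicator {x} y \<partial>lborel)"
      unfolding \<mu>_density by (intro emeasure_density) auto
    also have "\<dots> = 0"
      by (subst nn_integral_indicator_singleton) auto
    finally show ?thesis by (simp add: measure_def)
  qed
  have F_df: "nonneg_distribution_function F"
  proof -
    have "measure \<mu> {..<0} = 0"
      using \<mu>_pos by (subst \<mu>.prob_eq_0) auto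
    then show ?thesis
      using \<mu>_distr \<mu>.cdf_at_left[of 0] unfolding nonneg_distribution_function_def F_cdf by auto
  qed
  have \<mu>_moment: "integrable \<mu> (\<lambda>t. t powr \<alpha>)" and m_eq: "m = (\<integral>t. t powr \<alpha> \<partial>\<mu>)"
    unfolding \<mu>_def m using X moment by (simp_all add: integrable_distr_eq integral_distr)
  interpret kendall_moment \<alpha> F \<mu>
    by standard (use alpha F_df \<mu>.isCont_cdf no_atom F_cdf \<mu>_pos \<mu>_moment in auto)
  interpret self_neglecting_scale g
    using f_Gamma by (rule class_Gamma_scale)
  have "m > 0"
  proof -
    have "\<not> (AE t in \<mu>. t powr \<alpha> = 0)"
    proof
      assume "AE t in \<mu>. t powr \<alpha> = 0"
      with \<mu>_pos have "AE t in \<mu>. False"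
        by eventually_elim simp
      then show False
        using \<mu>.AE_False \<mu>.prob_space by auto
    qed
    then have "(\<integral>t. t powr \<alpha> \<partial>\<mu>) \<noteq> 0"
      using integral_nonneg_eq_0_iff_AE[OF \<mu>_moment] by auto
    moreover have "(\<integral>t. t powr \<alpha> \<partial>\<mu>) \<ge> 0"
      by (intro integral_nonneg_AE) auto
    ultimately show ?thesis unfolding m_eq by linarith
  qed

  define a where "a x = 1 - F x" for x
  define e where "e x = m - truncated_moment x" for x
  have a_nonneg: "0 \<le> a x" for x
    unfolding a_def using F_le_1 by simp
  have a_integral: "ennreal (a x) = (\<integral>\<^sup>+y. ennreal (f y) * indicator {x..} y \<partial>lborel)" for x
  proof -
    have "a x = measure \<mu> {x<..}" unfolding a_def by (rule tail_eq)
    also have "\<dots> = measure \<mu> {x..}"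
    proof -
      have "{x..} = {x} \<union> {x<..}" by auto
      then show ?thesis
        by (simp only:, subst \<mu>.finite_measure_Union) (auto simp: no_atom)
    qed
    finally have "ennreal (a x) = emeasure \<mu> {x..}"
      by (simp add: \<mu>.emeasure_eq_measure)
    also have "\<dots> = (\<integral>\<^sup>+y. ennreal (f y) * indicator {x..} y \<partial>lborel)"
      unfolding \<mu>_density by (intro emeasure_density) auto
    finally show ?thesis .
  qed
  have f_pos: "\<forall>\<^sub>F x in at_top. 0 < f x"
    using f_Gamma unfolding class_Gamma_def by simp

  have a_bounds: "\<forall>\<^sub>F x in at_top. g x * f x / 4 \<le> a x \<and> a x \<le> 4 * (g x * f x)"
    using class_Gamma_tail_integral[OF f_Gamma] g_pos
  proof eventually_elim
    case (elim x)
    have "0 \<le> 4 * (g x * f x)"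
      using elim(2) f_nonneg[of x] by simp
    then show ?case
      using elim a_nonneg[of x] unfolding a_integral[symmetric] by (simp only: ennreal_le_iff)
  qed
  \<comment> \<open>The defect is the tail integral of \<open>\<alpha> * u powr (\<alpha> - 1) * a u\<close>, whose integrand is itself
    bounded by a multiple of the function \<open>h\<close> in the class.\<close>
  have e_upper: "\<forall>\<^sub>F x in at_top. e x \<le> 16 * \<alpha> * (x powr (\<alpha> - 1) * (g x * (g x * f x)))"
  proof -
    define h where "h x = x powr (\<alpha> - 1) * g x * f x" for x
    have h: "h \<in> class_Gamma g"
      unfolding h_def by (rule class_Gamma_mult_scale[OF f_Gamma])
    then have [measurable]: "h \<in> borel_measurable borel"
      unfolding class_Gamma_def by simp
    obtain X1 where X1: "\<And>x. x \<ge> X1 \<Longrightarrow> a x \<le> 4 * (g x * f x)"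
      using a_bounds unfolding eventually_at_top_linorder by blast
    show ?thesis
      using class_Gamma_tail_integral[OF h] eventually_ge_at_top[of X1] eventually_gt_at_top[of 0] g_pos
    proof eventually_elim
      case (elim x)
      have "ennreal (e x) = (\<integral>\<^sup>+u. ennreal (\<alpha> * u powr (\<alpha> - 1) * a u) * indicator {x..} u \<partial>lborel)"
        unfolding e_def m_eq a_def using nn_integral_tail_eq[of x] elim by simp
      also have "\<dots> \<le> (\<integral>\<^sup>+u. ennreal (4 * \<alpha>) * (ennreal (h u) * indicator {x..} u) \<partial>lborel)"
      proof (intro nn_integral_mono)
        fix u
        show "ennreal (\<alpha> * u powr (\<alpha> - 1) * a u) * indicator {x..} u
            \<le> ennreal (4 * \<alpha>) * (ennreal (h u) * indicator {x..} u)"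
        proof (cases "u \<ge> x")
          case True
          then have "\<alpha> * u powr (\<alpha> - 1) * a u \<le> \<alpha> * u powr (\<alpha> - 1) * (4 * (g u * f u))"
            using X1[of u] elim alpha by (intro mult_left_mono) auto
          then have "ennreal (\<alpha> * u powr (\<alpha> - 1) * a u) \<le> ennreal (4 * \<alpha> * h u)"
            by (intro ennreal_leI) (simp add: h_def mult_ac)
          also have "\<dots> = ennreal (4 * \<alpha>) * ennreal (h u)"
            using alpha by (intro ennreal_mult') simp
          finally show ?thesis
            using True by simp
        qed simp
      qed
      also have "\<dots> = ennreal (4 * \<alpha>) * (\<integral>\<^sup>+u. ennreal (h u) * indicator {x..} u \<partial>lborel)"
        by (intro nn_integral_cmult) measurable
      also have "\<dots> \<le> ennreal (4 * \<alpha>) * ennreal (4 * (g x * h x))"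
        using elim by (intro mult_left_mono) auto
      also have "\<dots> = ennreal (4 * \<alpha> * (4 * (g x * h x)))"
        using alpha by (intro ennreal_mult'[symmetric]) simp
      finally have "e x \<le> 4 * \<alpha> * (4 * (g x * h x))"
        using elim alpha f_nonneg[of x] by (subst (asm) ennreal_le_iff) (auto simp: h_def)
      then show ?case by (simp add: h_def mult_ac)
    qed
  qed

  have truncated_moment_lim: "(truncated_moment \<longlongrightarrow> m) at_top"
    unfolding m_eq by (rule truncated_moment_at_top)
  have truncated_moment_pos: "\<forall>\<^sub>F x in at_top. 0 < truncated_moment x"
    using order_tendstoD(1)[OF truncated_moment_lim \<open>m > 0\<close>] .
  have d_lim: "((\<lambda>x. x powr \<alpha> * a x) \<longlongrightarrow> 0) at_top"
    unfolding a_def by (rule moment_tail_lim)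
  have e_nonneg: "\<forall>\<^sub>F x in at_top. 0 \<le> e x"
    using eventually_gt_at_top[of 0]
    by eventually_elim (use truncated_moment_le_moment in \<open>simp add: e_def m_eq\<close>)
  have e_le_a: "\<forall>\<^sub>F x in at_top. e x \<le> 64 * \<alpha> * (x powr (\<alpha> - 1) * (g x * a x))"
    using e_upper a_bounds g_pos
  proof eventually_elim
    case (elim x)
    note elim(1)
    also have "16 * \<alpha> * (x powr (\<alpha> - 1) * (g x * (g x * f x))) \<le> 16 * \<alpha> * (x powr (\<alpha> - 1) * (g x * (4 * a x)))"
      using elim alpha by (intro mult_left_mono) auto
    also have "\<dots> = 64 * \<alpha> * (x powr (\<alpha> - 1) * (g x * a x))"
      by simp
    finally show ?case .
  qed
  have a_pos: "\<forall>\<^sub>F x in at_top. 0 < a x"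
    using a_bounds g_pos f_pos
  proof eventually_elim
    case (elim x)
    then have "0 < g x * f x / 4" by simp
    then show ?case using elim by linarith
  qed
  have e_d_lim: "((\<lambda>x. e x / (x powr \<alpha> * a x)) \<longlongrightarrow> 0) at_top"
  proof (rule Lim_null_comparison)
    show "\<forall>\<^sub>F x in at_top. norm (e x / (x powr \<alpha> * a x)) \<le> 64 * \<alpha> * (g x / x)"
      using e_le_a e_nonneg a_pos eventually_gt_at_top[of 0]
    proof eventually_elim
      case (elim x)
      have "e x / (x powr \<alpha> * a x) \<le> 64 * \<alpha> * (x powr (\<alpha> - 1) * (g x * a x)) / (x powr \<alpha> * a x)"
        using elim by (intro divide_right_mono) auto
      also have "\<dots> = 64 * \<alpha> * (g x / x)"
        using elim by (simp add: powr_diff)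
      finally show ?case using elim by simp
    qed
    show "((\<lambda>x. 64 * \<alpha> * (g x / x)) \<longlongrightarrow> 0) at_top"
      using tendsto_mult_left[OF g_small, of "64 * \<alpha>"] by simp
  qed
  have xfe_lim: "((\<lambda>x. x * f x * e x / a x) \<longlongrightarrow> 0) at_top"
  proof (rule Lim_null_comparison)
    show "\<forall>\<^sub>F x in at_top. norm (x * f x * e x / a x) \<le> 256 * \<alpha> * (x powr \<alpha> * a x)"
      using e_le_a e_nonneg a_pos a_bounds eventually_gt_at_top[of 0]
    proof eventually_elim
      case (elim x)
      have "x * f x * e x / a x \<le> x * f x * (64 * \<alpha> * (x powr (\<alpha> - 1) * (g x * a x))) / a x"
        using elim f_nonneg[of x] by (intro divide_right_mono mult_left_mono) auto
      also have "\<dots> = 64 * \<alpha> * x powr \<alpha> * (g x * f x)"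
        using elim by (simp add: powr_diff)
      also have "\<dots> \<le> 64 * \<alpha> * x powr \<alpha> * (4 * a x)"
        using elim alpha by (intro mult_left_mono) auto
      finally show ?case using elim f_nonneg[of x] by simp
    qed
    show "((\<lambda>x. 256 * \<alpha> * (x powr \<alpha> * a x)) \<longlongrightarrow> 0) at_top"
      using tendsto_mult_left[OF d_lim, of "256 * \<alpha>"] by simp
  qed
  have a_xf_lim: "((\<lambda>x. a x / (x * f x)) \<longlongrightarrow> 0) at_top"
  proof (rule Lim_null_comparison)
    show "\<forall>\<^sub>F x in at_top. norm (a x / (x * f x)) \<le> 4 * (g x / x)"
      using a_pos a_bounds f_pos eventually_gt_at_top[of 0]
      by eventually_elim (simp add: field_simps)
    show "((\<lambda>x. 4 * (g x / x)) \<longlongrightarrow> 0) at_top"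
      using tendsto_mult_left[OF g_small, of 4] by simp
  qed

  define S where "S x = x * f x * e x / a x * ((m + truncated_moment x) / ((truncated_moment x)\<^sup>2 * m\<^sup>2))
    + 2 * \<alpha> * (e x / (x powr \<alpha> * a x) / (truncated_moment x * m) - 2 / (truncated_moment x)\<^sup>2 + x powr \<alpha> * a x / truncated_moment x ^ 3)" for x
  have S_lim: "(S \<longlongrightarrow> - (4 * \<alpha> / m\<^sup>2)) at_top"
  proof -
    have "(S \<longlongrightarrow> 0 * ((m + m) / (m\<^sup>2 * m\<^sup>2)) + 2 * \<alpha> * (0 / (m * m) - 2 / m\<^sup>2 + 0 / m ^ 3)) at_top"
      unfolding S_def using \<open>m > 0\<close>
      by (intro tendsto_intros truncated_moment_lim e_d_lim xfe_lim d_lim) auto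
    then show ?thesis by simp
  qed

  let ?D = "at_top_density_points F f"
  have D_le: "?D \<le> at_top"
    unfolding at_top_density_points_def by simp
  have D_points: "\<forall>\<^sub>F x in ?D. (F has_real_derivative f x) (at x)"
    unfolding at_top_density_points_def by (simp add: eventually_inf_principal)
  note at_D = filter_leD[OF D_le]

  have first: "\<forall>\<^sub>F x in ?D. 1 / (x powr (2 * \<alpha> - 1) * (1 - F x)) *
      (deriv R x - 2 * \<alpha> * x powr (\<alpha> - 1) / m - x powr (2 * \<alpha>) * f x / m\<^sup>2) = S x"
    using D_points at_D[OF eventually_gt_at_top[of 0]] at_D[OF truncated_moment_pos] at_D[OF a_pos]
  proof eventually_elim
    case (elim x)
    define p where "p = x powr \<alpha>"
    have p: "p > 0" "x powr (2 * \<alpha>) = p\<^sup>2" "x powr (\<alpha> - 1) = p / x" "x powr (2 * \<alpha> - 1) = p\<^sup>2 / x"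
      using elim by (simp_all add: p_def powr_diff powr_add[symmetric] power2_eq_square)
    have "deriv R x = p\<^sup>2 * f x / (truncated_moment x)\<^sup>2 + 2 * \<alpha> * (p / x) * (truncated_moment x - p * a x)\<^sup>2 / truncated_moment x ^ 3"
      unfolding R using deriv_kendall_renewal_truncated_moment[of x "f x"] elim by (simp add: p a_def p_def[symmetric])
    then show ?case
      using second_order_identity[of "a x" m p "truncated_moment x" x "e x" "f x" \<alpha>] elim p \<open>m > 0\<close>
      unfolding S_def p_def[symmetric] p(2-4) a_def[symmetric] by (simp add: e_def)
  qed
  have "((\<lambda>x. 1 / (x powr (2 * \<alpha> - 1) * (1 - F x)) *
      (deriv R x - 2 * \<alpha> * x powr (\<alpha> - 1) / m - x powr (2 * \<alpha>) * f x / m\<^sup>2))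
      \<longlongrightarrow> - (4 * \<alpha> / m\<^sup>2)) ?D"
    using tendsto_mono[OF D_le S_lim] first by (simp add: tendsto_cong)
  moreover have "((\<lambda>x. m\<^sup>2 / (x powr (2 * \<alpha>) * f x) * (deriv R x - 2 * \<alpha> * x powr (\<alpha> - 1) / m))
      \<longlongrightarrow> 1) ?D"
  proof -
    have "((\<lambda>x. m\<^sup>2 * (a x / (x * f x)) * S x + 1) \<longlongrightarrow> m\<^sup>2 * 0 * - (4 * \<alpha> / m\<^sup>2) + 1) at_top"
      by (intro tendsto_intros a_xf_lim S_lim)
    then have "((\<lambda>x. m\<^sup>2 * (a x / (x * f x)) * S x + 1) \<longlongrightarrow> 1) ?D"
      using tendsto_mono[OF D_le] by simp
    moreover have "\<forall>\<^sub>F x in ?D. m\<^sup>2 / (x powr (2 * \<alpha>) * f x) * (deriv R x - 2 * \<alpha> * x powr (\<alpha> - 1) / m)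
        = m\<^sup>2 * (a x / (x * f x)) * S x + 1"
      using first at_D[OF eventually_gt_at_top[of 0]] at_D[OF a_pos] at_D[OF f_pos]
    proof eventually_elim
      case (elim x)
      have p: "x powr (2 * \<alpha> - 1) = x powr (2 * \<alpha>) / x"
        using elim by (simp add: powr_diff)
      show ?case
        unfolding elim(1)[symmetric] p a_def[symmetric]
        using elim(2-4) \<open>m > 0\<close> by (simp add: field_simps)
    qed
    ultimately show ?thesis
      by (simp add: tendsto_cong)
  qed
  ultimately show ?thesis ..
qed

thm_deps theorem13

end
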